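(* Let $N\ge2$ and let $C\subset\mathbb{P}^N$ be an irreducible curve such that $C\cap\Delta_{N-2}=\emptyset$. Then: (1) for every $1\le r\le N$, $\dim\eta_r(C)=r$; (2) for every $p\in\mathbb{P}^N$, $\underline{\operatorname{Hrk}}_C(p)=\operatorname{Hrk}_C(p)\le N$, with equality $\operatorname{Hrk}_C(p)=N$ for generic $p\in\mathbb{P}^N$.
   Context: Work in $\mathbb{P}^N$ over $\mathbb{C}$. Hadamard product: $(p_0:\cdots:p_N)\star(q_0:\cdots:q_N)=(p_0q_0:\cdots:p_Nq_N)$, defined when not all $p_iq_i$ vanish. For varieties $X,Y$, $X\star Y$ is the Zariski closure of $\{p\star q: p\in X,q\in Y, p\star q\text{ defined}\}$; $X^{\star 0}=\{(1:\cdots:1)\}$, $X^{\star s}=X\star X^{\star(s-1)}$. $\operatorname{Hrk}_X(q)=\min\{m\mid q=p_1\star\cdots\star p_m,\ p_i\in X\}$ ($\infty$ if none). $\eta_m(X)=\overline{\{p\mid \operatorname{Hrk}_X(p)\le m\}}=X\cup X^{\star2}\cup\cdots\cup X^{\star m}$. Border Hadamard-$X$-rank: $\underline{\operatorname{Hrk}}_X(p)=\min\{m\mid p\in X^{\star m}\}$ ($\infty$ if none). $\Delta_{N-2}\subset\mathbb{P}^N$ is the set of points with at least two coordinates equal to zero. *)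

theory Defs
  imports Complex_Main "HOL-Library.Extended_Nat"
begin

section \<open>Projective space P^N over C via homogeneous coordinates\<close>

text \<open>A point of P^N is represented by any of its coordinate vectors
 x :: nat => complex with x i = 0 for i > N and x nonzero.  Subsets of P^N
 are represented by scaling-invariant sets of such vectors.\<close>

definition pts :: "nat \<Rightarrow> (nat \<Rightarrow> complex) set" where
  "pts N = {x. (\<forall>i>N. x i = 0) \<and> x \<noteq> (\<lambda>_. 0)}"

text \<open>Homogeneous polynomials in x_0..x_N: finitely supported coefficient
 functions on exponent vectors, all monomials of total degree d.\<close>

definition homog_poly :: "nat \<Rightarrow> nat \<Rightarrow> ((nat \<Rightarrow> nat) \<Rightarrow> complex) \<Rightarrow> bool" where
  "homog_poly N d c \<longleftrightarrow> finite {a. c a \<noteq> 0} \<and>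
     (\<forall>a. c a \<noteq> 0 \<longrightarrow> (\<forall>i>N. a i = 0) \<and> (\<Sum>i\<le>N. a i) = d)"

definition peval :: "nat \<Rightarrow> ((nat \<Rightarrow> nat) \<Rightarrow> complex) \<Rightarrow> (nat \<Rightarrow> complex) \<Rightarrow> complex" where
  "peval N c x = (\<Sum>a\<in>{a. c a \<noteq> 0}. c a * (\<Prod>i\<le>N. x i ^ a i))"

text \<open>Zariski closed subsets of P^N: common zero loci of families of
 homogeneous polynomials.\<close>

definition zclosed :: "nat \<Rightarrow> (nat \<Rightarrow> complex) set \<Rightarrow> bool" where
  "zclosed N S \<longleftrightarrow> (\<exists>F. (\<forall>(d, c)\<in>F. homog_poly N d c) \<and>
      S = {x\<in>pts N. \<forall>(d, c)\<in>F. peval N c x = 0})"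

definition zcl :: "nat \<Rightarrow> (nat \<Rightarrow> complex) set \<Rightarrow> (nat \<Rightarrow> complex) set" where
  "zcl N S = \<Inter>{T. zclosed N T \<and> S \<inter> pts N \<subseteq> T}"

definition zirred :: "nat \<Rightarrow> (nat \<Rightarrow> complex) set \<Rightarrow> bool" where
  "zirred N S \<longleftrightarrow> zclosed N S \<and> S \<noteq> {} \<and>
     (\<forall>A B. zclosed N A \<and> zclosed N B \<and> S = A \<union> B \<longrightarrow> S = A \<or> S = B)"

text \<open>Krull dimension: supremum of lengths n of strict chains
 Z_0 < Z_1 < ... < Z_n of irreducible closed subsets of S.\<close>

definition zchain :: "nat \<Rightarrow> (nat \<Rightarrow> complex) set \<Rightarrow> nat \<Rightarrow> bool" where
  "zchain N S n \<longleftrightarrow> (\<exists>Z :: nat \<Rightarrow> (nat \<Rightarrow> complex) set.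
      (\<forall>i\<le>n. zirred N (Z i) \<and> Z i \<subseteq> S) \<and> (\<forall>i<n. Z i \<subset> Z (Suc i)))"

definition zdim :: "nat \<Rightarrow> (nat \<Rightarrow> complex) set \<Rightarrow> enat" where
  "zdim N S = Sup {enat n | n. zchain N S n}"

section \<open>Hadamard products\<close>

definition hprod :: "(nat \<Rightarrow> complex) \<Rightarrow> (nat \<Rightarrow> complex) \<Rightarrow> (nat \<Rightarrow> complex)" where
  "hprod p q = (\<lambda>i. p i * q i)"

definition ones :: "nat \<Rightarrow> (nat \<Rightarrow> complex)" where
  "ones N = (\<lambda>i. if i \<le> N then 1 else 0)"

definition hstar :: "nat \<Rightarrow> (nat \<Rightarrow> complex) set \<Rightarrow> (nat \<Rightarrow> complex) set \<Rightarrow> (nat \<Rightarrow> complex) set" where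
  "hstar N X Y = zcl N {hprod p q | p q. p \<in> X \<and> q \<in> Y \<and> hprod p q \<in> pts N}"

fun hpow :: "nat \<Rightarrow> (nat \<Rightarrow> complex) set \<Rightarrow> nat \<Rightarrow> (nat \<Rightarrow> complex) set" where
  "hpow N X 0 = {x\<in>pts N. \<exists>c. c \<noteq> 0 \<and> x = (\<lambda>i. c * ones N i)}"
| "hpow N X (Suc s) = hstar N X (hpow N X s)"

text \<open>p = p_1 * ... * p_m (as projective points) with all p_i in X.
 For m = 0 the empty product is (1:...:1).\<close>

definition hdecomp :: "nat \<Rightarrow> (nat \<Rightarrow> complex) set \<Rightarrow> (nat \<Rightarrow> complex) \<Rightarrow> nat \<Rightarrow> bool" where
  "hdecomp N X p m \<longleftrightarrow> p \<in> pts N \<and> (\<exists>ps. length ps = m \<and> set ps \<subseteq> X \<and>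
      (\<exists>c. c \<noteq> 0 \<and> p = (\<lambda>i. c * foldr hprod ps (ones N) i)))"

definition Hrk :: "nat \<Rightarrow> (nat \<Rightarrow> complex) set \<Rightarrow> (nat \<Rightarrow> complex) \<Rightarrow> enat" where
  "Hrk N X p = (if \<exists>m. hdecomp N X p m then enat (LEAST m. hdecomp N X p m) else \<infinity>)"

definition bHrk :: "nat \<Rightarrow> (nat \<Rightarrow> complex) set \<Rightarrow> (nat \<Rightarrow> complex) \<Rightarrow> enat" where
  "bHrk N X p = (if \<exists>m. p \<in> hpow N X m then enat (LEAST m. p \<in> hpow N X m) else \<infinity>)"

text \<open>eta_r(X) = closure of the points of Hadamard-X-rank between 1 and r
 (= X \<union> X^{*2} \<union> ... \<union> X^{*r}).\<close>

definition eta :: "nat \<Rightarrow> (nat \<Rightarrow> complex) set \<Rightarrow> nat \<Rightarrow> (nat \<Rightarrow> complex) set" where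
  "eta N X r = zcl N {p\<in>pts N. \<exists>m. 1 \<le> m \<and> m \<le> r \<and> hdecomp N X p m}"

definition Delta :: "nat \<Rightarrow> (nat \<Rightarrow> complex) set" where
  "Delta N = {x\<in>pts N. \<exists>i j. i \<le> N \<and> j \<le> N \<and> i \<noteq> j \<and> x i = 0 \<and> x j = 0}"

end

(*
  A point of C has at most one zero coordinate, so a product of m points of C has at most m zeros:
  for m <= N it is always defined, and m-fold products never vanish on m + 1 coordinates at once.

  Closedness: the product map is the Segre embedding followed by a linear projection whose centre
  misses the Segre variety. Such projections are closed; one coordinate at a time this is an
  argument with resultants.  Hence border rank and rank agree.

  Upper bound: if a closed set X does not meet x_0 = ... = x_r = 0, its coordinate ring is finite
  over C[x_0..x_r], so forms of degree d restrict to X in a space of dimension O(d^r), whereas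
  the end of a chain of k + 1 irreducible sets carries at least (d + k choose k) independent forms
  of degree dE for some E.

  Lower bound: C meets every hyperplane x_j = 0, in q_j say (otherwise C would have dimension 0), and
  q_0 ... q_{r-1} * C^0 < ... < q_0 * C^(r-1) < C^r is a strict chain.  In particular C^N = P^N.
  The point (0 : ... : 0 : 1) has N zeros, hence is not a product of fewer than N points.
*)

theory Submission
  imports Defs "Jordan_Normal_Form.Determinant" "HOL-Computational_Algebra.Fundamental_Theorem_Algebra"
begin

section \<open>Forms and closed cones\<close>

text \<open>Avoiding Delta has two consequences that fit together: products of at most N points stay
  away from zero, and r-fold products miss the linear space x_0 = ... = x_r = 0, which is the
  hypothesis of the dimension bound. That bound is applied to three sets of coordinates: x_0, ...,
  x_r for eta_r; one coordinate alone, where it leaves no room for a curve that misses a coordinate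
  hyperplane; and all coordinates, where it forbids a chain of length N + 1 in P^N. A proper closed
  C^N would extend to such a chain. Two obstacles shape the details. The resultant that separates a
  point from a projection need not be homogeneous, so it is split into components, using that the
  image is a cone. And the terms of the chain are images under multiplication that are not known to
  be closed; irreducibility is therefore expressed by primality of the vanishing forms, which makes
  sense for any set and survives closure.\<close>

definition expo :: "'i set \<Rightarrow> nat \<Rightarrow> ('i \<Rightarrow> nat) set" where
  "expo I d = {a. (\<forall>i. i \<notin> I \<longrightarrow> a i = 0) \<and> sum a I = d}"

definition xpow :: "'i set \<Rightarrow> ('i \<Rightarrow> nat) \<Rightarrow> ('i \<Rightarrow> complex) \<Rightarrow> complex" where
  "xpow I a x = (\<Prod>i\<in>I. x i ^ a i)"

text \<open>Forms are kept as functions on coordinate vectors, so that products, substitutions and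
  restrictions are those of functions; coefficients are unpacked only where they matter.\<close>

definition forms :: "'i set \<Rightarrow> nat \<Rightarrow> (('i \<Rightarrow> complex) \<Rightarrow> complex) set" where
  "forms I d = {f. \<exists>c. f = (\<lambda>x. \<Sum>a\<in>expo I d. c a * xpow I a x)}"

lemma finite_expo:
  assumes "finite I"
  shows "finite (expo I d)"
proof (rule finite_subset)
  show "expo I d \<subseteq> {a. \<forall>i. (i \<in> I \<longrightarrow> a i \<in> {..d}) \<and> (i \<notin> I \<longrightarrow> a i = 0)}"
    using assms by (auto simp: expo_def intro!: member_le_sum)
  show "finite {a. \<forall>i. (i \<in> I \<longrightarrow> a i \<in> {..d}) \<and> (i \<notin> I \<longrightarrow> a i = 0)}"
    using finite_set_of_finite_funs[OF assms, of "{..d}" "0::nat"] by simp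
qed

lemma xpow_add: "xpow I (\<lambda>i. a i + b i) x = xpow I a x * xpow I b x"
  by (simp add: xpow_def power_add prod.distrib)

lemma expo_add: "a \<in> expo I d \<Longrightarrow> b \<in> expo I e \<Longrightarrow> (\<lambda>i. a i + b i) \<in> expo I (d + e)"
  by (auto simp: expo_def sum.distrib)

lemma xpow_cong: "(\<And>i. i \<in> I \<Longrightarrow> x i = y i) \<Longrightarrow> xpow I a x = xpow I a y"
  by (simp add: xpow_def)

lemma xpow_homogeneous:
  assumes "finite I" "a \<in> expo I d"
  shows "xpow I a (\<lambda>i. s * x i) = s ^ d * xpow I a x"
  using assms by (auto simp: xpow_def expo_def power_mult_distrib prod.distrib power_sum)

lemma forms_cong:
  assumes "f \<in> forms I d" "\<And>i. i \<in> I \<Longrightarrow> x i = y i"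
  shows "f x = f y"
  using assms xpow_cong[of I x y] by (auto simp: forms_def)

lemma forms_homogeneous:
  assumes "finite I" "f \<in> forms I d"
  shows "f (\<lambda>i. s * x i) = s ^ d * f x"
proof -
  obtain c where f: "f = (\<lambda>x. \<Sum>a\<in>expo I d. c a * xpow I a x)"
    using assms by (auto simp: forms_def)
  show ?thesis unfolding f sum_distrib_left
    by (rule sum.cong) (auto simp: xpow_homogeneous[OF assms(1)])
qed

lemma forms_zero: "(\<lambda>_. 0) \<in> forms I d"
  unfolding forms_def by (auto intro!: exI[of _ "\<lambda>_. 0"])

lemma forms_xpow:
  assumes "finite I" "a \<in> expo I d"
  shows "xpow I a \<in> forms I d"
proof -
  have "xpow I a x = (\<Sum>b\<in>expo I d. (if b = a then 1 else 0) * xpow I b x)" for x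
  proof -
    have "(\<Sum>b\<in>expo I d. (if b = a then 1 else 0) * xpow I b x) =
        (\<Sum>b\<in>expo I d. if b = a then xpow I b x else 0)"
      by (rule sum.cong) auto
    then show ?thesis using assms finite_expo[OF assms(1), of d] by (simp add: sum.delta)
  qed
  then have "xpow I a = (\<lambda>x. \<Sum>b\<in>expo I d. (if b = a then 1 else 0) * xpow I b x)" by blast
  then show ?thesis unfolding forms_def by (intro CollectI exI[of _ "\<lambda>b. if b = a then 1 else 0"])
qed

lemma forms_add:
  assumes "f \<in> forms I d" "g \<in> forms I d"
  shows "(\<lambda>x. f x + g x) \<in> forms I d"
proof -
  obtain c c' where "f = (\<lambda>x. \<Sum>a\<in>expo I d. c a * xpow I a x)"
    "g = (\<lambda>x. \<Sum>a\<in>expo I d. c' a * xpow I a x)"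
    using assms by (auto simp: forms_def)
  then have "(\<lambda>x. f x + g x) = (\<lambda>x. \<Sum>a\<in>expo I d. (c a + c' a) * xpow I a x)"
    by (simp add: sum.distrib distrib_right)
  then show ?thesis by (auto simp: forms_def)
qed

lemma forms_scale:
  assumes "f \<in> forms I d"
  shows "(\<lambda>x. s * f x) \<in> forms I d"
proof -
  obtain c where "f = (\<lambda>x. \<Sum>a\<in>expo I d. c a * xpow I a x)"
    using assms by (auto simp: forms_def)
  then have "(\<lambda>x. s * f x) = (\<lambda>x. \<Sum>a\<in>expo I d. (s * c a) * xpow I a x)"
    by (simp add: sum_distrib_left mult.assoc)
  then show ?thesis by (auto simp: forms_def)
qed

lemma forms_sum:
  assumes "\<And>a. a \<in> A \<Longrightarrow> g a \<in> forms I d"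
  shows "(\<lambda>x. \<Sum>a\<in>A. g a x) \<in> forms I d"
  using assms by (induction A rule: infinite_finite_induct) (auto intro: forms_zero forms_add)

lemma forms_mult:
  assumes "finite I" "f \<in> forms I d" "g \<in> forms I e"
  shows "(\<lambda>x. f x * g x) \<in> forms I (d + e)"
proof -
  obtain c c' where "f = (\<lambda>x. \<Sum>a\<in>expo I d. c a * xpow I a x)"
    "g = (\<lambda>x. \<Sum>a\<in>expo I e. c' a * xpow I a x)"
    using assms by (auto simp: forms_def)
  then have "(\<lambda>x. f x * g x) =
      (\<lambda>x. \<Sum>a\<in>expo I d. \<Sum>b\<in>expo I e. (c a * c' b) * xpow I (\<lambda>i. a i + b i) x)"
    by (simp only: sum_product xpow_add mult.assoc mult.left_commute[of "xpow _ _ _"])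
  also have "\<dots> \<in> forms I (d + e)"
    by (intro forms_sum forms_scale forms_xpow assms expo_add)
  finally show ?thesis .
qed

lemma forms_const: "finite I \<Longrightarrow> (\<lambda>_. s) \<in> forms I 0"
  using forms_scale[OF forms_xpow[of I "\<lambda>_. 0" 0], of s] by (simp add: expo_def xpow_def)

lemma forms_coord:
  assumes "finite I" "i \<in> I"
  shows "(\<lambda>x. x i) \<in> forms I 1"
proof -
  let ?a = "\<lambda>j. if j = i then 1 else 0 :: nat"
  have "xpow I ?a = (\<lambda>x. x i)"
    using assms by (auto simp: xpow_def if_distrib[of "\<lambda>u. _ ^ u"] prod.delta cong: if_cong)
  moreover have "?a \<in> expo I 1"
    using assms by (auto simp: expo_def sum.delta)
  ultimately show ?thesis using forms_xpow[OF assms(1)] by metis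
qed

lemma forms_power:
  assumes "finite I" "f \<in> forms I d"
  shows "(\<lambda>x. f x ^ n) \<in> forms I (n * d)"
  by (induction n) (use assms in \<open>auto intro: forms_const forms_mult\<close>)

lemma forms_prod:
  assumes "finite K" "\<And>i. i \<in> A \<Longrightarrow> g i \<in> forms K (e i)"
  shows "(\<lambda>x. \<Prod>i\<in>A. g i x) \<in> forms K (sum e A)"
  using assms(2)
  by (induction A rule: infinite_finite_induct) (auto intro: forms_const forms_mult assms(1))

lemma forms_linear_subst:
  assumes "finite I" "finite K" "f \<in> forms I d" "\<And>i. i \<in> I \<Longrightarrow> u i \<in> forms K 1"
  shows "(\<lambda>y. f (\<lambda>i. u i y)) \<in> forms K d"
proof -
  obtain c where f: "f = (\<lambda>x. \<Sum>a\<in>expo I d. c a * xpow I a x)"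
    using assms by (auto simp: forms_def)
  have "(\<lambda>y. \<Prod>i\<in>I. u i y ^ a i) \<in> forms K d" if "a \<in> expo I d" for a
  proof -
    have "(\<lambda>y. \<Prod>i\<in>I. u i y ^ a i) \<in> forms K (sum a I)"
      by (rule forms_prod) (use forms_power[OF assms(2,4)] assms(2) in auto)
    then show ?thesis using that by (simp add: expo_def)
  qed
  then show ?thesis unfolding f xpow_def by (intro forms_sum forms_scale)
qed

definition Pts :: "'i set \<Rightarrow> ('i \<Rightarrow> complex) set" where
  "Pts I = {x. (\<forall>i. i \<notin> I \<longrightarrow> x i = 0) \<and> x \<noteq> (\<lambda>_. 0)}"

text \<open>Projective closedness, over an arbitrary index set of coordinates so that it also applies
  to matrices (the Segre variety): every point outside is separated by a form.\<close>

definition zcone :: "'i set \<Rightarrow> ('i \<Rightarrow> complex) set \<Rightarrow> bool" where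
  "zcone I S \<longleftrightarrow> S \<subseteq> Pts I \<and>
     (\<forall>x\<in>Pts I - S. \<exists>d. \<exists>f\<in>forms I d. (\<forall>y\<in>S. f y = 0) \<and> f x \<noteq> 0)"

lemma zconeI:
  assumes "S \<subseteq> Pts I"
    and "\<And>x. x \<in> Pts I \<Longrightarrow> (\<And>d f. f \<in> forms I d \<Longrightarrow> (\<And>y. y \<in> S \<Longrightarrow> f y = 0) \<Longrightarrow> f x = 0) \<Longrightarrow> x \<in> S"
  shows "zcone I S"
  using assms unfolding zcone_def by blast

lemma zconeD:
  assumes "zcone I S" "x \<in> Pts I"
    and "\<And>d f. f \<in> forms I d \<Longrightarrow> (\<And>y. y \<in> S \<Longrightarrow> f y = 0) \<Longrightarrow> f x = 0"
  shows "x \<in> S"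
  using assms unfolding zcone_def by blast

lemma zcone_separate:
  assumes "zcone I S" "x \<in> Pts I" "x \<notin> S"
  obtains d f where "f \<in> forms I d" "\<And>y. y \<in> S \<Longrightarrow> f y = 0" "f x \<noteq> 0"
  using assms unfolding zcone_def by blast

lemma Pts_scale: "x \<in> Pts I \<Longrightarrow> s \<noteq> 0 \<Longrightarrow> (\<lambda>i. s * x i) \<in> Pts I"
  by (auto simp: Pts_def fun_eq_iff)

lemma zcone_scale:
  assumes "finite I" "zcone I S" "x \<in> S" "s \<noteq> 0"
  shows "(\<lambda>i. s * x i) \<in> S"
  using assms(2)
proof (rule zconeD)
  show "(\<lambda>i. s * x i) \<in> Pts I" using assms by (auto simp: zcone_def intro: Pts_scale)
next
  fix d f assume f: "f \<in> forms I d" "\<And>y. y \<in> S \<Longrightarrow> f y = 0"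
  show "f (\<lambda>i. s * x i) = 0"
    using forms_homogeneous[OF assms(1) f(1), of s x] f(2)[OF assms(3)] by simp
qed

lemma zcone_Int:
  assumes "\<And>S. S \<in> \<S> \<Longrightarrow> zcone I S" "\<S> \<noteq> {}"
  shows "zcone I (\<Inter>\<S>)"
proof (rule zconeI)
  show "\<Inter>\<S> \<subseteq> Pts I" using assms by (auto simp: zcone_def)
  fix x assume x: "x \<in> Pts I" "\<And>d f. f \<in> forms I d \<Longrightarrow> (\<And>y. y \<in> \<Inter>\<S> \<Longrightarrow> f y = 0) \<Longrightarrow> f x = 0"
  show "x \<in> \<Inter>\<S>"
  proof
    fix S assume "S \<in> \<S>"
    then show "x \<in> S" using zconeD[OF assms(1) x(1), of S] x(2) by blast
  qed
qed

lemma zcone_Un: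
  assumes "finite I" "zcone I S" "zcone I T"
  shows "zcone I (S \<union> T)"
proof (rule zconeI)
  show "S \<union> T \<subseteq> Pts I" using assms by (auto simp: zcone_def)
  fix x assume x: "x \<in> Pts I"
    "\<And>d f. f \<in> forms I d \<Longrightarrow> (\<And>y. y \<in> S \<union> T \<Longrightarrow> f y = 0) \<Longrightarrow> f x = 0"
  show "x \<in> S \<union> T"
  proof (rule ccontr)
    assume "x \<notin> S \<union> T"
    then have nS: "x \<notin> S" and nT: "x \<notin> T" by auto
    obtain d f where f: "f \<in> forms I d" "\<And>y. y \<in> S \<Longrightarrow> f y = 0" "f x \<noteq> 0"
      using zcone_separate[OF assms(2) x(1) nS] by blast
    obtain e g where g: "g \<in> forms I e" "\<And>y. y \<in> T \<Longrightarrow> g y = 0" "g x \<noteq> 0"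
      using zcone_separate[OF assms(3) x(1) nT] by blast
    show False
      using x(2)[OF forms_mult[OF assms(1) f(1) g(1)]] f g by auto
  qed
qed

lemma zcone_empty:
  assumes "finite I"
  shows "zcone I {}"
proof (rule zconeI)
  fix x
  assume "\<And>d f. f \<in> forms I d \<Longrightarrow> (\<And>y. y \<in> {} \<Longrightarrow> f y = 0) \<Longrightarrow> f x = 0"
  from this[OF forms_const[OF assms, of 1]] show "x \<in> {}" by simp
qed auto

lemma zcone_UN:
  assumes "finite I" "finite A" "\<And>a. a \<in> A \<Longrightarrow> zcone I (S a)"
  shows "zcone I (\<Union>a\<in>A. S a)"
  using assms(2,3) by (induction A) (auto intro: zcone_empty zcone_Un assms(1))

lemma zcone_Pts: "zcone I (Pts I)"
  by (auto simp: zcone_def)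

lemma zcone_zero_locus:
  assumes "zcone I S" "f \<in> forms I d"
  shows "zcone I {x\<in>S. f x = 0}"
proof (rule zconeI)
  show "{x \<in> S. f x = 0} \<subseteq> Pts I" using assms by (auto simp: zcone_def)
  fix x assume x: "x \<in> Pts I"
    "\<And>d g. g \<in> forms I d \<Longrightarrow> (\<And>y. y \<in> {x \<in> S. f x = 0} \<Longrightarrow> g y = 0) \<Longrightarrow> g x = 0"
  have "x \<in> S" by (rule zconeD[OF assms(1) x(1)]) (use x(2) in blast)
  then show "x \<in> {x \<in> S. f x = 0}" using x(2)[OF assms(2)] by auto
qed

section \<open>Comparison with the polynomials, closed sets and closures of the statement\<close>

lemma pts_eq: "pts N = Pts {..N}"
  by (auto simp: pts_def Pts_def)

lemma homog_peval_form:
  assumes "homog_poly N d c"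
  shows "peval N c \<in> forms {..N} d"
proof -
  have "{a. c a \<noteq> 0} \<subseteq> expo {..N} d"
    using assms by (auto simp: homog_poly_def expo_def)
  then have "peval N c x = (\<Sum>a\<in>expo {..N} d. c a * xpow {..N} a x)" for x
    unfolding peval_def xpow_def by (intro sum.mono_neutral_left finite_expo) auto
  then show ?thesis by (auto simp: forms_def)
qed

lemma form_eq_peval:
  assumes "f \<in> forms {..N} d"
  obtains c where "homog_poly N d c" "f = peval N c"
proof -
  obtain c where f: "f = (\<lambda>x. \<Sum>a\<in>expo {..N} d. c a * xpow {..N} a x)"
    using assms by (auto simp: forms_def)
  \<comment> \<open>\<open>homog_poly\<close> restricts the support of the coefficient function,
    while \<open>c\<close> is arbitrary outside \<open>expo {..N} d\<close>.\<close>
  define c' where "c' a = (if a \<in> expo {..N} d then c a else 0)" for a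
  have sub: "{a. c' a \<noteq> 0} \<subseteq> expo {..N} d" by (auto simp: c'_def)
  have "f = peval N c'"
  proof
    fix x
    have "peval N c' x = (\<Sum>a\<in>expo {..N} d. c' a * xpow {..N} a x)"
      unfolding peval_def xpow_def using sub by (intro sum.mono_neutral_left finite_expo) auto
    then show "f x = peval N c' x" by (simp add: f c'_def)
  qed
  moreover have "homog_poly N d c'"
    unfolding homog_poly_def using sub finite_subset[OF sub finite_expo]
    by (auto simp: expo_def)
  ultimately show thesis using that by blast
qed

lemma zclosed_iff: "zclosed N S \<longleftrightarrow> zcone {..N} S"
proof
  assume "zclosed N S"
  then obtain F where F: "\<forall>(d, c)\<in>F. homog_poly N d c"
    "S = {x\<in>pts N. \<forall>(d, c)\<in>F. peval N c x = 0}"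
    by (auto simp: zclosed_def)
  show "zcone {..N} S"
  proof (rule zconeI)
    show "S \<subseteq> Pts {..N}" using F by (auto simp: pts_eq)
    fix x assume x: "x \<in> Pts {..N}"
      "\<And>d f. f \<in> forms {..N} d \<Longrightarrow> (\<And>y. y \<in> S \<Longrightarrow> f y = 0) \<Longrightarrow> f x = 0"
    have "peval N c x = 0" if "(d, c) \<in> F" for d c
      by (rule x(2)[OF homog_peval_form]) (use F that in auto)
    then show "x \<in> S" using x(1) by (auto simp: F(2) pts_eq)
  qed
next
  assume S: "zcone {..N} S"
  \<comment> \<open>All forms vanishing on \<open>S\<close>: the largest family that can define
    it.\<close>
  let ?F = "{(d, c). homog_poly N d c \<and> (\<forall>x\<in>S. peval N c x = 0)}"
  have "S = {x\<in>pts N. \<forall>(d, c)\<in>?F. peval N c x = 0}"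
  proof
    show "S \<subseteq> {x\<in>pts N. \<forall>(d, c)\<in>?F. peval N c x = 0}"
      using S by (auto simp: zcone_def pts_eq)
    show "{x\<in>pts N. \<forall>(d, c)\<in>?F. peval N c x = 0} \<subseteq> S"
    proof
      fix x assume x: "x \<in> {x\<in>pts N. \<forall>(d, c)\<in>?F. peval N c x = 0}"
      show "x \<in> S"
      proof (rule zconeD[OF S])
        show "x \<in> Pts {..N}" using x by (simp add: pts_eq)
        fix d f assume f: "f \<in> forms {..N} d" "\<And>y. y \<in> S \<Longrightarrow> f y = 0"
        obtain c where "homog_poly N d c" "f = peval N c" using form_eq_peval[OF f(1)] .
        then show "f x = 0" using x f(2) by auto
      qed
    qed
  qed
  then show "zclosed N S" unfolding zclosed_def by (intro exI[of _ ?F]) auto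
qed

lemma zcl_zcone: "zcone {..N} (zcl N S)"
  unfolding zcl_def
  by (rule zcone_Int) (use zcone_Pts in \<open>auto simp: zclosed_iff pts_eq\<close>)

lemma zcl_minimal: "zcone {..N} T \<Longrightarrow> S \<subseteq> T \<Longrightarrow> zcl N S \<subseteq> T"
  by (auto simp: zcl_def zclosed_iff)

lemma zcl_superset: "S \<subseteq> Pts {..N} \<Longrightarrow> S \<subseteq> zcl N S"
  by (auto simp: zcl_def pts_eq)

lemma zcl_eq: "zcone {..N} S \<Longrightarrow> zcl N S = S"
  by (meson zcone_def subset_antisym order_refl zcl_minimal zcl_superset)

lemma form_zcl_zero:
  assumes "f \<in> forms {..N} d" "S \<subseteq> Pts {..N}" "\<And>x. x \<in> S \<Longrightarrow> f x = 0" "x \<in> zcl N S"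
  shows "f x = 0"
  using zcl_minimal[OF zcone_zero_locus[OF zcone_Pts assms(1)], of S] assms by auto

section \<open>Projection from a point\<close>

text \<open>Polynomial functions without homogeneity. The resultants below may mix degrees and are
  only known to be of this kind; \<open>poly_separates_cone\<close> extracts a form from
  them.\<close>

inductive_set polys :: "'i set \<Rightarrow> (('i \<Rightarrow> complex) \<Rightarrow> complex) set" for I where
  polys_form: "f \<in> forms I d \<Longrightarrow> f \<in> polys I"
| polys_add: "f \<in> polys I \<Longrightarrow> g \<in> polys I \<Longrightarrow> (\<lambda>x. f x + g x) \<in> polys I"

lemma polys_cong:
  assumes "f \<in> polys I" "\<And>i. i \<in> I \<Longrightarrow> x i = y i"
  shows "f x = f y"
  using assms(1) by induction (auto intro: forms_cong[OF _ assms(2)])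

lemma polys_const: "finite I \<Longrightarrow> (\<lambda>_. c) \<in> polys I"
  by (rule polys_form[OF forms_const])

lemma polys_mult:
  assumes "finite I" "f \<in> polys I" "g \<in> polys I"
  shows "(\<lambda>x. f x * g x) \<in> polys I"
  using assms(2)
proof induction
  case (polys_form f d)
  note f = polys_form
  from assms(3) show ?case
  proof induction
    case (polys_form g e)
    then show ?case by (intro polys.polys_form[OF forms_mult[OF assms(1) f]])
  next
    case (polys_add g h)
    then show ?case by (simp add: distrib_left polys.polys_add)
  qed
next
  case (polys_add f h)
  then show ?case by (simp add: distrib_right polys.polys_add)
qed

lemma polys_sum:
  assumes "finite I" "\<And>a. a \<in> A \<Longrightarrow> g a \<in> polys I"
  shows "(\<lambda>x. \<Sum>a\<in>A. g a x) \<in> polys I"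
  using assms(2)
  by (induction A rule: infinite_finite_induct) (auto intro: polys_const polys_add assms(1))

lemma polys_prod:
  assumes "finite I" "\<And>a. a \<in> A \<Longrightarrow> g a \<in> polys I"
  shows "(\<lambda>x. \<Prod>a\<in>A. g a x) \<in> polys I"
  using assms(2)
  by (induction A rule: infinite_finite_induct) (auto intro: polys_const polys_mult assms(1))

lemma polys_homogeneous_components:
  assumes "g \<in> polys I"
  obtains n h where "\<And>d. h d \<in> forms I d" "g = (\<lambda>x. \<Sum>d<n. h d x)"
proof -
  \<comment> \<open>The vanishing of \<open>h d\<close> for d >= n lets two decompositions be padded
    to a common length before they are added.\<close>
  have "\<exists>n h. (\<forall>d. h d \<in> forms I d) \<and> (\<forall>d\<ge>n. h d = (\<lambda>_. 0)) \<and> g = (\<lambda>x. \<Sum>d<n. h d x)"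
    using assms
  proof induction
    case (polys_form f d)
    let ?h = "\<lambda>e. if e = d then f else (\<lambda>_. 0)"
    have "f = (\<lambda>x. \<Sum>e<Suc d. ?h e x)"
      by (auto simp: fun_eq_iff)
    then show ?case using polys_form
      by (intro exI[of _ "Suc d"] exI[of _ ?h]) (auto intro: forms_zero)
  next
    case (polys_add f g)
    then obtain n h m k where h: "\<forall>d. h d \<in> forms I d" "\<forall>d\<ge>n. h d = (\<lambda>_. 0)" "f = (\<lambda>x. \<Sum>d<n. h d x)"
      and k: "\<forall>d. k d \<in> forms I d" "\<forall>d\<ge>m. k d = (\<lambda>_. 0)" "g = (\<lambda>x. \<Sum>d<m. k d x)"
      by blast
    have "(\<Sum>d<n. h d x) = (\<Sum>d<max n m. h d x)" "(\<Sum>d<m. k d x) = (\<Sum>d<max n m. k d x)" for x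
      by (rule sum.mono_neutral_left; use h(2) k(2) in \<open>auto simp: not_less\<close>)+
    then have "(\<lambda>x. f x + g x) = (\<lambda>x. \<Sum>d<max n m. h d x + k d x)"
      by (simp add: h(3) k(3) sum.distrib)
    then show ?case using h k
      by (intro exI[of _ "max n m"] exI[of _ "\<lambda>d x. h d x + k d x"]) (auto intro: forms_add)
  qed
  then show thesis using that by blast
qed

text \<open>For \<open>x\<close> in \<open>S\<close> the values h_d(x) of the homogeneous components
  of \<open>g\<close> are the coefficients of the polynomial g(s x) in s. It vanishes for all s
  \<noteq> 0, so each component vanishes on \<open>S\<close>; at \<open>a\<close> some component is
  nonzero because their sum is.\<close>

lemma poly_separates_cone:
  assumes "finite I" "g \<in> polys I" "\<And>x s. x \<in> S \<Longrightarrow> s \<noteq> 0 \<Longrightarrow> (\<lambda>i. s * x i) \<in> S"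
    and "\<And>x. x \<in> S \<Longrightarrow> g x = 0" "g a \<noteq> 0"
  shows "\<exists>d. \<exists>f\<in>forms I d. (\<forall>x\<in>S. f x = 0) \<and> f a \<noteq> 0"
proof -
  obtain n h where h: "\<And>d. h d \<in> forms I d" "g = (\<lambda>x. \<Sum>d<n. h d x)"
    using polys_homogeneous_components[OF assms(2)] by blast
  have zero: "h d x = 0" if "x \<in> S" "d < n" for x d
  proof -
    define P where "P = (\<Sum>d<n. monom (h d x) d)"
    have P: "poly P s = g (\<lambda>i. s * x i)" for s
      by (simp add: P_def h(2) poly_sum poly_monom forms_homogeneous[OF assms(1) h(1)] mult.commute)
    have "P = 0"
    proof (rule ccontr)
      assume "P \<noteq> 0"
      then have "finite {s. poly P s = 0}" by (rule poly_roots_finite)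
      moreover have "UNIV - {0} \<subseteq> {s. poly P s = 0}"
        using assms(3)[OF \<open>x \<in> S\<close>] assms(4) by (auto simp: P)
      ultimately have "finite (UNIV - {0 :: complex})" using finite_subset by blast
      then show False using infinite_UNIV_char_0[where 'a=complex] by simp
    qed
    moreover have "coeff P d = h d x"
      using \<open>d < n\<close> by (simp add: P_def coeff_sum)
    ultimately show ?thesis by simp
  qed
  have "\<exists>d<n. h d a \<noteq> 0"
    using assms(5) unfolding h(2) by (metis (no_types, lifting) lessThan_iff sum.neutral)
  then show ?thesis using zero h(1) by blast
qed

text \<open>Polynomials in x_k over the polynomial functions in the other coordinates. The degree
  bound uniform in \<open>x\<close> allows a Sylvester matrix of fixed size.\<close>

definition upoly :: "'i set \<Rightarrow> 'i \<Rightarrow> (('i \<Rightarrow> complex) \<Rightarrow> complex poly) set" where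
  "upoly I k = {P. (\<exists>n. \<forall>x. degree (P x) \<le> n) \<and> (\<forall>j. (\<lambda>x. coeff (P x) j) \<in> polys (I - {k}))}"

lemma upoly_add: "P \<in> upoly I k \<Longrightarrow> Q \<in> upoly I k \<Longrightarrow> (\<lambda>x. P x + Q x) \<in> upoly I k"
proof -
  assume a: "P \<in> upoly I k" "Q \<in> upoly I k"
  then obtain n m where "\<forall>x. degree (P x) \<le> n" "\<forall>x. degree (Q x) \<le> m"
    by (auto simp: upoly_def)
  then have "degree (P x + Q x) \<le> max n m" for x
    by (meson degree_add_le max.coboundedI1 max.coboundedI2)
  then show ?thesis using a by (auto simp: upoly_def intro: polys_add)
qed

lemma upoly_mult_const:
  assumes "finite I" "P \<in> upoly I k"
  shows "(\<lambda>x. q * P x) \<in> upoly I k"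
proof -
  obtain n where "\<forall>x. degree (P x) \<le> n" using assms by (auto simp: upoly_def)
  then have "degree (q * P x) \<le> degree q + n" for x
    by (meson add_left_mono degree_mult_le order_trans)
  moreover have "(\<lambda>x. coeff (q * P x) j) \<in> polys (I - {k})" for j
    unfolding coeff_mult using assms
    by (intro polys_sum polys_mult polys_const) (auto simp: upoly_def)
  ultimately show ?thesis by (auto simp: upoly_def)
qed

section \<open>Forms as polynomials in one coordinate\<close>

definition form_poly :: "'i set \<Rightarrow> 'i \<Rightarrow> nat \<Rightarrow> (('i \<Rightarrow> nat) \<Rightarrow> complex) \<Rightarrow> ('i \<Rightarrow> complex) \<Rightarrow> complex poly" where
  "form_poly I k d c x = (\<Sum>a\<in>expo I d. monom (c a * xpow (I - {k}) a x) (a k))"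

lemma xpow_remove:
  assumes "finite I" "k \<in> I"
  shows "xpow I a x = x k ^ a k * xpow (I - {k}) a x"
  using assms by (simp add: xpow_def prod.remove)

lemma poly_form_poly:
  assumes "finite I" "k \<in> I"
  shows "poly (form_poly I k d c x) t = (\<Sum>a\<in>expo I d. c a * xpow I a (x(k := t)))"
proof -
  have "xpow (I - {k}) a (x(k := t)) = xpow (I - {k}) a x" for a
    by (rule xpow_cong) auto
  then show ?thesis
    by (simp add: form_poly_def poly_sum poly_monom xpow_remove[OF assms] mult_ac)
qed

lemma coeff_form_poly: "coeff (form_poly I k d c x) j =
    (\<Sum>a\<in>expo I d. if a k = j then c a * xpow (I - {k}) a x else 0)"
  by (simp add: form_poly_def coeff_sum)

lemma degree_form_poly:
  assumes "finite I" "k \<in> I"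
  shows "degree (form_poly I k d c x) \<le> d"
proof (rule degree_le, intro allI impI)
  fix j assume "d < j"
  moreover have "a k \<le> d" if "a \<in> expo I d" for a
    using that assms by (auto simp: expo_def intro!: member_le_sum)
  ultimately show "coeff (form_poly I k d c x) j = 0"
    unfolding coeff_form_poly by (intro sum.neutral) force
qed

lemma form_poly_upoly:
  assumes "finite I" "k \<in> I"
  shows "form_poly I k d c \<in> upoly I k"
proof -
  have "(\<lambda>x. if a k = j then c a * xpow (I - {k}) a x else 0) \<in> polys (I - {k})"
    if "a \<in> expo I d" for a j
  proof -
    define b where "b i = (if i = k then 0 else a i)" for i
    have "xpow (I - {k}) a = xpow (I - {k}) b"
      by (auto simp: xpow_def b_def)
    moreover have "b \<in> expo (I - {k}) (sum b (I - {k}))"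
      using that by (auto simp: expo_def b_def)
    ultimately have "xpow (I - {k}) a \<in> polys (I - {k})"
      using polys_form[OF forms_xpow] assms by (metis finite_Diff)
    then have "(\<lambda>x. c a * xpow (I - {k}) a x) \<in> polys (I - {k})"
      using assms by (intro polys_mult polys_const) auto
    then show ?thesis using assms by (cases "a k = j") (auto intro: polys_const)
  qed
  then have "(\<lambda>x. coeff (form_poly I k d c x) j) \<in> polys (I - {k})" for j
    unfolding coeff_form_poly using assms by (intro polys_sum) auto
  then show ?thesis using degree_form_poly[OF assms, of d c] unfolding upoly_def by blast
qed

definition pure :: "'i \<Rightarrow> nat \<Rightarrow> 'i \<Rightarrow> nat" where
  "pure k d = (\<lambda>i. if i = k then d else 0)"

lemma pure_expo: "finite I \<Longrightarrow> k \<in> I \<Longrightarrow> pure k d \<in> expo I d"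
  by (auto simp: pure_def expo_def sum.delta)

lemma expo_eq_pure:
  assumes "finite I" "k \<in> I" "a \<in> expo I d" "a k = d"
  shows "a = pure k d"
proof
  fix i
  have "sum a I = a k + sum a (I - {k})" using assms by (simp add: sum.remove)
  then have "sum a (I - {k}) = 0" using assms by (simp add: expo_def)
  then have "\<forall>i\<in>I - {k}. a i = 0" using assms by simp
  then show "a i = pure k d i" using assms by (cases "i \<in> I") (auto simp: pure_def expo_def)
qed

text \<open>\<open>pure k d\<close> is the only exponent vector of total degree \<open>d\<close>
  with value \<open>d\<close> at \<open>k\<close>, so the coefficient of x_k^d is a constant, free
  of \<open>x\<close>.\<close>

lemma coeff_form_poly_top:
  assumes "finite I" "k \<in> I"
  shows "coeff (form_poly I k d c x) d = c (pure k d)"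
proof -
  have "coeff (form_poly I k d c x) d =
      (\<Sum>a\<in>expo I d. if a = pure k d then c a * xpow (I - {k}) a x else 0)"
    unfolding coeff_form_poly
  proof (rule sum.cong)
    fix a assume "a \<in> expo I d"
    then have "a k = d \<longleftrightarrow> a = pure k d"
      using expo_eq_pure[OF assms] by (auto simp: pure_def)
    then show "(if a k = d then c a * xpow (I - {k}) a x else 0) =
        (if a = pure k d then c a * xpow (I - {k}) a x else 0)" by simp
  qed simp
  also have "\<dots> = c (pure k d) * xpow (I - {k}) (pure k d) x"
    using finite_expo[OF assms(1), of d] pure_expo[OF assms, of d] by (simp add: sum.delta')
  also have "xpow (I - {k}) (pure k d) x = 1" by (auto simp: xpow_def pure_def)
  finally show ?thesis by simp
qed

text \<open>The unit vector is the centre of the projection that drops x_k: a form is nonzero there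
  exactly when it contains x_k^d.\<close>

lemma form_at_unit_vector:
  assumes "finite I" "k \<in> I"
  shows "(\<Sum>a\<in>expo I d. c a * xpow I a (\<lambda>i. if i = k then 1 else 0)) = c (pure k d)"
proof -
  have "xpow I a (\<lambda>i. if i = k then 1 else 0) = (if a = pure k d then 1 else 0)"
    if a: "a \<in> expo I d" for a
  proof (cases "a = pure k d")
    case True
    then show ?thesis by (auto simp: xpow_def pure_def intro!: prod.neutral)
  next
    case False
    then have "a k \<noteq> d" using expo_eq_pure[OF assms a] by auto
    have "\<exists>i\<in>I - {k}. a i \<noteq> 0"
    proof (rule ccontr)
      assume "\<not> ?thesis"
      then have "sum a I = a k" using assms by (simp add: sum.remove)
      then show False using a \<open>a k \<noteq> d\<close> by (simp add: expo_def)
    qed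
    then show ?thesis using False assms by (auto simp: xpow_def power_0_left intro!: prod_zero)
  qed
  then have "(\<Sum>a\<in>expo I d. c a * xpow I a (\<lambda>i. if i = k then 1 else 0)) =
      (\<Sum>a\<in>expo I d. if a = pure k d then c a else 0)"
    by (intro sum.cong) auto
  then show ?thesis
    using finite_expo[OF assms(1), of d] pure_expo[OF assms, of d] by (simp add: sum.delta')
qed

text \<open>The centre of the projection, the unit vector at \<open>k\<close>, is not in
  \<open>X\<close>, so some form vanishing on \<open>X\<close> is nonzero there. Its value there is
  the coefficient of x_k^e, and dividing by it makes the form monic in x_k.\<close>

lemma monic_equation:
  assumes "finite I" "k \<in> I" "zcone I X" "\<And>x. x \<in> X \<Longrightarrow> \<exists>i\<in>I - {k}. x i \<noteq> 0"
  obtains e c where "c (pure k e) = 1"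
    "\<And>x. x \<in> X \<Longrightarrow> (\<Sum>a\<in>expo I e. c a * xpow I a x) = 0"
proof -
  let ?u = "\<lambda>i. if i = k then 1 else 0 :: complex"
  have "?u \<in> Pts I" using assms by (auto simp: Pts_def fun_eq_iff)
  moreover have "?u \<notin> X" using assms(4)[of ?u] by auto
  ultimately obtain e f where f: "f \<in> forms I e" "\<And>y. y \<in> X \<Longrightarrow> f y = 0" "f ?u \<noteq> 0"
    using zcone_separate[OF assms(3)] by blast
  obtain c where c: "f = (\<lambda>x. \<Sum>a\<in>expo I e. c a * xpow I a x)"
    using f(1) by (auto simp: forms_def)
  have nz: "c (pure k e) \<noteq> 0" using f(3) form_at_unit_vector[OF assms(1,2)] by (simp add: c)
  show thesis
  proof (rule that[of "\<lambda>a. c a / c (pure k e)" e])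
    show "c (pure k e) / c (pure k e) = 1" using nz by simp
    fix x assume "x \<in> X"
    have "(\<Sum>a\<in>expo I e. c a / c (pure k e) * xpow I a x) = f x / c (pure k e)"
      by (simp add: c sum_divide_distrib)
    then show "(\<Sum>a\<in>expo I e. c a / c (pure k e) * xpow I a x) = 0"
      using f(2)[OF \<open>x \<in> X\<close>] by simp
  qed
qed

text \<open>Otherwise all the $P_a$ with $P$ vanishing on $X$ have a common root $t$, and then
  $(a, t)$ lies in $X$ and projects to $a$.\<close>

lemma unit_over_missed_point:
  assumes "finite I" "k \<in> I" "zcone I X" "\<And>x. x \<in> X \<Longrightarrow> \<exists>i\<in>I - {k}. x i \<noteq> 0"
    and "a \<in> Pts (I - {k})" "a \<notin> (\<lambda>x. x(k := 0)) ` X"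
  obtains P where "P \<in> upoly I k" "P a = 1" "\<And>x. x \<in> X \<Longrightarrow> poly (P x) (x k) = 0"
proof -
  \<comment> \<open>The values at \<open>a\<close> of all such \<open>P\<close> form an ideal of the
    one-variable polynomial ring; the aim is to show that it contains 1.\<close>
  define J where "J = {P a | P. P \<in> upoly I k \<and> (\<forall>x\<in>X. poly (P x) (x k) = 0)}"
  have J_form: "form_poly I k d c a \<in> J"
    if "\<And>x. x \<in> X \<Longrightarrow> (\<Sum>a\<in>expo I d. c a * xpow I a x) = 0" for d c
  proof -
    have "poly (form_poly I k d c x) (x k) = 0" if "x \<in> X" for x
      using that \<open>\<And>x. x \<in> X \<Longrightarrow> (\<Sum>a\<in>expo I d. c a * xpow I a x) = 0\<close>
      by (simp add: poly_form_poly[OF assms(1,2)])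
    then show ?thesis using form_poly_upoly[OF assms(1,2)] unfolding J_def by blast
  qed
  have J_add: "u + v \<in> J" if "u \<in> J" "v \<in> J" for u v
  proof -
    obtain P where "u = P a" "P \<in> upoly I k" "\<forall>x\<in>X. poly (P x) (x k) = 0"
      using \<open>u \<in> J\<close> unfolding J_def mem_Collect_eq by (elim exE conjE)
    moreover obtain Q where "v = Q a" "Q \<in> upoly I k" "\<forall>x\<in>X. poly (Q x) (x k) = 0"
      using \<open>v \<in> J\<close> unfolding J_def mem_Collect_eq by (elim exE conjE)
    ultimately show ?thesis unfolding J_def
      by (intro CollectI exI[of _ "\<lambda>x. P x + Q x"]) (simp add: upoly_add)
  qed
  have J_mult: "q * u \<in> J" if "u \<in> J" for q u
  proof -
    obtain P where "u = P a" "P \<in> upoly I k" "\<forall>x\<in>X. poly (P x) (x k) = 0"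
      using \<open>u \<in> J\<close> unfolding J_def mem_Collect_eq by (elim exE conjE)
    then show ?thesis unfolding J_def
      by (intro CollectI exI[of _ "\<lambda>x. q * P x"]) (simp add: upoly_mult_const[OF assms(1)])
  qed
  obtain e c where mc: "c (pure k e) = 1"
    "\<And>x. x \<in> X \<Longrightarrow> (\<Sum>a\<in>expo I e. c a * xpow I a x) = 0"
    using monic_equation[OF assms(1-4)] by blast
  \<comment> \<open>The monic equation puts a nonzero polynomial into \<open>J\<close>, so an
    element of least degree exists, and division with remainder shows that it generates
    \<open>J\<close>.\<close>
  have "form_poly I k e c a \<in> J" by (rule J_form) (rule mc(2))
  moreover have "form_poly I k e c a \<noteq> 0"
    using coeff_form_poly_top[OF assms(1,2), of e c a] mc(1) by auto
  ultimately obtain u where u: "u \<in> J" "u \<noteq> 0" "\<And>v. v \<in> J \<Longrightarrow> v \<noteq> 0 \<Longrightarrow> degree u \<le> degree v"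
    using ex_has_least_nat[of "\<lambda>u. u \<in> J \<and> u \<noteq> 0" _ degree] by blast
  have dvd: "u dvd v" if "v \<in> J" for v
  proof -
    have "v mod u = v + (- (v div u)) * u" by (simp add: minus_div_mult_eq_mod[symmetric])
    then have "v mod u \<in> J" using J_add[OF that J_mult[OF u(1)]] by metis
    then have "v mod u = 0"
      using u(3) degree_mod_less[OF u(2), of v] by (metis leD)
    then show ?thesis by (simp add: mod_eq_0_iff_dvd)
  qed
  have "degree u = 0"
  proof (rule ccontr)
    assume "degree u \<noteq> 0"
    then have "\<not> constant (poly u)" by (simp add: constant_degree)
    then obtain t where t: "poly u t = 0" using fundamental_theorem_of_algebra by blast
    have "a(k := t) \<in> X"
    proof (rule zconeD[OF assms(3)])
      show "a(k := t) \<in> Pts I"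
        using assms(2,5) by (auto simp: Pts_def fun_eq_iff)
      fix d f assume f: "f \<in> forms I d" "\<And>y. y \<in> X \<Longrightarrow> f y = 0"
      obtain b where b: "f = (\<lambda>x. \<Sum>a\<in>expo I d. b a * xpow I a x)"
        using f(1) by (auto simp: forms_def)
      have "form_poly I k d b a \<in> J" by (rule J_form) (use f(2) in \<open>simp add: b\<close>)
      then have "u dvd form_poly I k d b a" by (rule dvd)
      then have "poly (form_poly I k d b a) t = 0" using t by (auto elim!: dvdE)
      then show "f (a(k := t)) = 0" by (simp add: b poly_form_poly[OF assms(1,2)])
    qed
    moreover have "(a(k := t))(k := 0) = a" using assms(5) by (auto simp: Pts_def)
    ultimately show False using assms(6) by (metis imageI)
  qed
  then have "is_unit u" using u(2) by (simp add: is_unit_iff_degree)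
  then obtain v where "v * u = 1" by (metis dvd_def mult.commute)
  then have "1 \<in> J" using J_mult[OF u(1), of v] by simp
  then show thesis using that unfolding J_def by auto
qed

section \<open>Sylvester determinants\<close>

definition sylv :: "nat \<Rightarrow> nat \<Rightarrow> complex poly \<Rightarrow> complex poly \<Rightarrow> complex mat" where
  "sylv e n p q = mat (e + n) (e + n)
     (\<lambda>(i, j). coeff (if i < e then monom 1 i * p else monom 1 (i - e) * q) j)"

text \<open>Row i lists the coefficients of t^i p or of t^(i - e) q, so applying it to the powers of
  t evaluates that polynomial. The size comes from the bounds \<open>n\<close> and \<open>e\<close>
  rather than from the degrees, so that it stays fixed when \<open>p\<close> and \<open>q\<close>
  vary with a point.\<close>

lemma sylv_mult_powers:
  assumes "degree p \<le> n" "degree q \<le> e"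
  shows "sylv e n p q *\<^sub>v vec (e + n) (\<lambda>j. t ^ j) =
    vec (e + n) (\<lambda>i. if i < e then t ^ i * poly p t else t ^ (i - e) * poly q t)"
proof (rule eq_vecI)
  fix i assume "i < dim_vec (vec (e + n) (\<lambda>i. if i < e then t ^ i * poly p t else t ^ (i - e) * poly q t))"
  then have i: "i < e + n" by simp
  define r where "r = (if i < e then monom 1 i * p else monom 1 (i - e) * q)"
  have "degree r < e + n"
  proof (cases "i < e")
    case True
    then have "degree r \<le> i + degree p"
      using degree_mult_le[of "monom 1 i" p] by (simp add: r_def degree_monom_eq)
    then show ?thesis using True assms by simp
  next
    case False
    then have "degree r \<le> i - e + degree q"
      using degree_mult_le[of "monom 1 (i - e)" q] by (simp add: r_def degree_monom_eq)
    then show ?thesis using False assms i by simp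
  qed
  then have "(\<Sum>j<e + n. coeff r j * t ^ j) = poly r t"
    unfolding poly_altdef by (intro sum.mono_neutral_right) (auto simp: coeff_eq_0)
  moreover have "poly r t = (if i < e then t ^ i * poly p t else t ^ (i - e) * poly q t)"
    by (simp add: r_def poly_monom)
  moreover have "(sylv e n p q *\<^sub>v vec (e + n) (\<lambda>j. t ^ j)) $ i = (\<Sum>j<e + n. coeff r j * t ^ j)"
    using i by (auto simp: sylv_def scalar_prod_def r_def lessThan_atLeast0 intro!: sum.cong)
  ultimately show "(sylv e n p q *\<^sub>v vec (e + n) (\<lambda>j. t ^ j)) $ i =
      vec (e + n) (\<lambda>i. if i < e then t ^ i * poly p t else t ^ (i - e) * poly q t) $ i"
    using i by simp
qed (simp add: sylv_def)

text \<open>At a common root the vector (1, t, t^2, ...) lies in the kernel; since 0 < n it has the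
  entry 1 at index 0.\<close>

lemma det_sylv_common_root:
  assumes "degree p \<le> n" "degree q \<le> e" "poly p t = 0" "poly q t = 0" "0 < n"
  shows "det (sylv e n p q) = 0"
proof -
  let ?v = "vec (e + n) (\<lambda>j. t ^ j)"
  have "?v \<in> carrier_vec (e + n)" by simp
  moreover have "?v \<noteq> 0\<^sub>v (e + n)"
  proof
    assume "?v = 0\<^sub>v (e + n)"
    then have "?v $ 0 = 0\<^sub>v (e + n) $ 0" by simp
    then show False using assms(5) by simp
  qed
  moreover have "sylv e n p q *\<^sub>v ?v = 0\<^sub>v (e + n)"
    using assms by (auto simp: sylv_mult_powers)
  moreover have "sylv e n p q \<in> carrier_mat (e + n) (e + n)" by (simp add: sylv_def)
  ultimately show ?thesis using det_0_iff_vec_prod_zero_field by blast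
qed

text \<open>For p = 1 the leading \<open>e\<close> rows are unit vectors and the others are shifts
  of the monic \<open>q\<close>, so the matrix is lower triangular with unit diagonal, however
  generous the bound \<open>n\<close> is for the constant 1.\<close>

lemma det_sylv_one:
  assumes "degree q \<le> e" "coeff q e = 1"
  shows "det (sylv e n 1 q) = 1"
proof -
  have "det (sylv e n 1 q) = prod_list (diag_mat (sylv e n 1 q))"
  proof (rule det_lower_triangular)
    show "sylv e n 1 q \<in> carrier_mat (e + n) (e + n)" by (simp add: sylv_def)
    fix i j assume ij: "i < j" "j < e + n"
    then show "sylv e n 1 q $$ (i, j) = 0"
      using assms(1) by (auto simp: sylv_def coeff_monom_mult coeff_monom intro!: coeff_eq_0)
  qed
  also have "diag_mat (sylv e n 1 q) = map (\<lambda>_. 1) [0..<e + n]"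
    using assms(2) unfolding diag_mat_def
    by (intro map_cong) (auto simp: sylv_def coeff_monom_mult)
  finally show ?thesis by (simp add: map_replicate_const)
qed

text \<open>By the Leibniz expansion, since every entry is 0 or a coefficient of \<open>P x\<close>
  or \<open>Q x\<close>.\<close>

lemma det_sylv_polys:
  assumes "finite I" "P \<in> upoly I k" "Q \<in> upoly I k"
  shows "(\<lambda>x. det (sylv e n (P x) (Q x))) \<in> polys (I - {k})"
proof -
  have fin: "finite (I - {k})" using assms by simp
  have entry: "(\<lambda>x. sylv e n (P x) (Q x) $$ (i, j)) \<in> polys (I - {k})"
    if ij: "i < e + n" "j < e + n" for i j
  proof (cases "i < e")
    case True
    then have "(\<lambda>x. sylv e n (P x) (Q x) $$ (i, j)) =
        (\<lambda>x. if j < i then 0 else coeff (P x) (j - i))"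
      using ij by (auto simp: sylv_def coeff_monom_mult)
    then show ?thesis
      using assms(2) polys_const[OF fin] by (cases "j < i") (auto simp: upoly_def)
  next
    case False
    then have "(\<lambda>x. sylv e n (P x) (Q x) $$ (i, j)) =
        (\<lambda>x. if j < i - e then 0 else coeff (Q x) (j - (i - e)))"
      using ij by (auto simp: sylv_def coeff_monom_mult)
    then show ?thesis
      using assms(3) polys_const[OF fin] by (cases "j < i - e") (auto simp: upoly_def)
  qed
  have "det (sylv e n (P x) (Q x)) = (\<Sum>p\<in>{p. p permutes {0..<e + n}}.
      signof p * (\<Prod>i = 0..<e + n. sylv e n (P x) (Q x) $$ (i, p i)))" for x
    by (simp add: det_def sylv_def)
  moreover have "(\<lambda>x. \<Sum>p\<in>{p. p permutes {0..<e + n}}.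
      signof p * (\<Prod>i = 0..<e + n. sylv e n (P x) (Q x) $$ (i, p i))) \<in> polys (I - {k})"
    by (intro polys_sum polys_mult polys_prod polys_const fin entry)
      (auto dest: permutes_in_image)
  ultimately show ?thesis by simp
qed

text \<open>A missed point \<open>a\<close> is separated from the image by a resultant in x_k,
  namely that of a \<open>P\<close> vanishing on \<open>X\<close> with P a = 1 and of the monic
  equation \<open>Q\<close>. Over the image both have the root x_k, so it is 0; at \<open>a\<close>
  it is 1.\<close>

theorem projection_zcone:
  assumes "finite I" "k \<in> I" "zcone I X" "\<And>x. x \<in> X \<Longrightarrow> \<exists>i\<in>I - {k}. x i \<noteq> 0"
  shows "zcone (I - {k}) ((\<lambda>x. x(k := 0)) ` X)"
proof -
  let ?\<pi> = "\<lambda>x :: 'a \<Rightarrow> complex. x(k := 0)"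
  have fin: "finite (I - {k})" using assms by simp
  have "\<exists>d. \<exists>f\<in>forms (I - {k}) d. (\<forall>y\<in>?\<pi> ` X. f y = 0) \<and> f a \<noteq> 0"
    if a: "a \<in> Pts (I - {k})" "a \<notin> ?\<pi> ` X" for a
  proof -
    obtain P where P: "P \<in> upoly I k" "P a = 1" "\<And>x. x \<in> X \<Longrightarrow> poly (P x) (x k) = 0"
      using unit_over_missed_point[OF assms a] by blast
    obtain e c where mc: "c (pure k e) = 1"
      "\<And>x. x \<in> X \<Longrightarrow> (\<Sum>a\<in>expo I e. c a * xpow I a x) = 0"
      using monic_equation[OF assms] by blast
    define Q where "Q = form_poly I k e c"
    obtain m where m: "\<And>x. degree (P x) \<le> m" using P(1) by (auto simp: upoly_def)
    have dQ: "degree (Q x) \<le> e" for x by (simp add: Q_def degree_form_poly[OF assms(1,2)])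
    \<comment> \<open>\<open>Suc m\<close> rather than \<open>m\<close>, since
      \<open>det_sylv_common_root\<close> asks for a positive bound.\<close>
    define g where "g x = det (sylv e (Suc m) (P x) (Q x))" for x
    have g: "g \<in> polys (I - {k})"
      using det_sylv_polys[OF assms(1) P(1), of Q] form_poly_upoly[OF assms(1,2)]
      by (simp add: Q_def g_def[abs_def])
    show ?thesis
    proof (rule poly_separates_cone[OF fin g])
      fix y s assume ys: "y \<in> ?\<pi> ` X" "(s::complex) \<noteq> 0"
      then obtain x where "x \<in> X" "y = ?\<pi> x" by auto
      then show "(\<lambda>i. s * y i) \<in> ?\<pi> ` X"
        using zcone_scale[OF assms(1,3) _ ys(2)]
        by (intro image_eqI[of _ _ "\<lambda>i. s * x i"]) auto
    next
      fix y assume "y \<in> ?\<pi> ` X"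
      then obtain x where x: "x \<in> X" "y = ?\<pi> x" by auto
      \<comment> \<open>The determinant does not involve coordinate \<open>k\<close>, so it may be
        computed at the point \<open>x\<close> of \<open>X\<close> above \<open>y\<close>.\<close>
      have "g y = g x" by (rule polys_cong[OF g]) (simp add: x)
      also have "g x = 0" unfolding g_def
      proof (rule det_sylv_common_root)
        show "degree (P x) \<le> Suc m" using m by (rule le_SucI)
        show "poly (Q x) (x k) = 0"
          using mc(2)[OF x(1)] by (simp add: Q_def poly_form_poly[OF assms(1,2)])
      qed (use dQ P(3) x in auto)
      finally show "g y = 0" .
    next
      have "coeff (Q a) e = 1" by (simp add: Q_def coeff_form_poly_top[OF assms(1,2)] mc(1))
      then show "g a \<noteq> 0" by (simp add: g_def P(2) det_sylv_one[OF dQ])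
    qed
  qed
  moreover have "?\<pi> ` X \<subseteq> Pts (I - {k})"
  proof
    fix y assume "y \<in> ?\<pi> ` X"
    then obtain x where x: "x \<in> X" "y = ?\<pi> x" by auto
    moreover obtain i where "i \<in> I - {k}" "x i \<noteq> 0" using assms(4) x by blast
    ultimately show "y \<in> Pts (I - {k})" using assms(3)
      by (auto simp: zcone_def Pts_def fun_eq_iff)
  qed
  ultimately show ?thesis unfolding zcone_def by blast
qed

section \<open>Projections with empty centre are finite\<close>

definition restr :: "'i set \<Rightarrow> ('i \<Rightarrow> complex) \<Rightarrow> 'i \<Rightarrow> complex" where
  "restr J x = (\<lambda>i. if i \<in> J then x i else 0)"

text \<open>The span of the monomials of \<open>A\<close> inside the coordinate ring of
  \<open>X\<close>: functions are compared on \<open>X\<close> only.\<close>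

definition span_on :: "('i \<Rightarrow> complex) set \<Rightarrow> 'i set \<Rightarrow> ('i \<Rightarrow> nat) set \<Rightarrow> (('i \<Rightarrow> complex) \<Rightarrow> complex) set" where
  "span_on X I A = {g. \<exists>c. \<forall>x\<in>X. g x = (\<Sum>b\<in>A. c b * xpow I b x)}"

lemma span_on_base:
  assumes "finite A" "b \<in> A"
  shows "xpow I b \<in> span_on X I A"
proof -
  have "xpow I b x = (\<Sum>a\<in>A. (if a = b then 1 else 0) * xpow I a x)" for x
  proof -
    have "(\<Sum>a\<in>A. (if a = b then 1 else 0) * xpow I a x) = (\<Sum>a\<in>A. if a = b then xpow I a x else 0)"
      by (rule sum.cong) auto
    then show ?thesis using assms by (simp add: sum.delta)
  qed
  then show ?thesis
    unfolding span_on_def by (intro CollectI exI[of _ "\<lambda>a. if a = b then 1 else 0"] ballI)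
qed

lemma span_on_scale:
  assumes "g \<in> span_on X I A"
  shows "(\<lambda>x. s * g x) \<in> span_on X I A"
proof -
  obtain c where "\<forall>x\<in>X. g x = (\<Sum>b\<in>A. c b * xpow I b x)"
    using assms by (auto simp: span_on_def)
  then show ?thesis unfolding span_on_def
    by (intro CollectI exI[of _ "\<lambda>b. s * c b"]) (simp add: sum_distrib_left mult.assoc)
qed

lemma span_on_add:
  assumes "g \<in> span_on X I A" "h \<in> span_on X I A"
  shows "(\<lambda>x. g x + h x) \<in> span_on X I A"
proof -
  obtain c c' where "\<forall>x\<in>X. g x = (\<Sum>b\<in>A. c b * xpow I b x)" "\<forall>x\<in>X. h x = (\<Sum>b\<in>A. c' b * xpow I b x)"
    using assms by (auto simp: span_on_def)
  then show ?thesis unfolding span_on_def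
    by (intro CollectI exI[of _ "\<lambda>b. c b + c' b"]) (simp add: sum.distrib distrib_right)
qed

lemma span_on_sum:
  assumes "\<And>b. b \<in> B \<Longrightarrow> g b \<in> span_on X I A"
  shows "(\<lambda>x. \<Sum>b\<in>B. g b x) \<in> span_on X I A"
  using assms
proof (induction B rule: infinite_finite_induct)
  case (insert b B)
  then show ?case by (auto intro: span_on_add)
qed (auto simp: span_on_def intro!: exI[of _ "\<lambda>_. 0"])

lemma span_on_cong:
  assumes "g \<in> span_on X I A" "\<And>x. x \<in> X \<Longrightarrow> h x = g x"
  shows "h \<in> span_on X I A"
  using assms by (auto simp: span_on_def)

lemma span_on_trans:
  assumes "g \<in> span_on X I B" "\<And>b. b \<in> B \<Longrightarrow> xpow I b \<in> span_on X I A"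
  shows "g \<in> span_on X I A"
proof -
  obtain c where c: "\<And>x. x \<in> X \<Longrightarrow> g x = (\<Sum>b\<in>B. c b * xpow I b x)"
    using assms by (auto simp: span_on_def)
  have "(\<lambda>x. \<Sum>b\<in>B. c b * xpow I b x) \<in> span_on X I A"
    by (intro span_on_sum span_on_scale assms(2))
  then show ?thesis using c by (rule span_on_cong)
qed

text \<open>The monic equation rewrites x_k^e on \<open>X\<close> through monomials of the same
  degree with smaller exponent at \<open>k\<close>; repeating this lowers the exponent at
  \<open>k\<close> until it is below \<open>e\<close>.\<close>

lemma monic_reduction:
  assumes "finite I" "k \<in> I" "c (pure k e) = 1"
    "\<And>x. x \<in> X \<Longrightarrow> (\<Sum>a\<in>expo I e. c a * xpow I a x) = 0"
    and "a \<in> expo I d"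
  shows "xpow I a \<in> span_on X I {b\<in>expo I d. b k < e}"
  using assms(5)
proof (induction "a k" arbitrary: a rule: less_induct)
  case less
  have fin: "finite {b\<in>expo I d. b k < e}" using finite_expo[OF assms(1)] by simp
  show ?case
  proof (cases "a k < e")
    case True
    then show ?thesis using less fin by (intro span_on_base) auto
  next
    case False
    define a' where "a' = a(k := a k - e)"
    have a_eq: "a = (\<lambda>i. a' i + pure k e i)" using False by (auto simp: a'_def pure_def)
    have a': "a' \<in> expo I (d - e)"
    proof -
      have "sum a I = sum a' I + sum (pure k e) I"
        by (subst a_eq) (simp add: sum.distrib)
      then show ?thesis
        using less.prems pure_expo[OF assms(1,2), of e] False by (auto simp: expo_def a'_def)
    qed
    have "a k \<le> d"
      using less.prems assms(1,2) by (auto simp: expo_def intro!: member_le_sum)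
    then have de: "d - e + e = d" using False by simp
    let ?R = "expo I e - {pure k e}"
    have "xpow I a x = (\<Sum>b\<in>?R. - c b * xpow I (\<lambda>i. a' i + b i) x)" if "x \<in> X" for x
    proof -
      have "0 = xpow I (pure k e) x + (\<Sum>b\<in>?R. c b * xpow I b x)"
        using assms(4)[OF that] sum.remove[OF finite_expo[OF assms(1)] pure_expo[OF assms(1,2)],
            of "\<lambda>b. c b * xpow I b x"] assms(3) by simp
      then have "xpow I (pure k e) x = (\<Sum>b\<in>?R. - c b * xpow I b x)"
        by (simp add: sum_negf eq_neg_iff_add_eq_0)
      then have "xpow I a x = xpow I a' x * (\<Sum>b\<in>?R. - c b * xpow I b x)"
        by (subst a_eq) (simp add: xpow_add)
      then show ?thesis by (simp add: sum_distrib_left xpow_add mult_ac)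
    qed
    moreover have "(\<lambda>x. \<Sum>b\<in>?R. - c b * xpow I (\<lambda>i. a' i + b i) x) \<in> span_on X I {b\<in>expo I d. b k < e}"
    proof (intro span_on_sum span_on_scale less.hyps)
      fix b assume b: "b \<in> ?R"
      then have "b k \<noteq> e" using expo_eq_pure[OF assms(1,2)] by blast
      moreover have "b k \<le> e"
        using b assms(1,2) by (auto simp: expo_def intro!: member_le_sum)
      ultimately show "a' k + b k < a k" using False by (simp add: a'_def)
      show "(\<lambda>i. a' i + b i) \<in> expo I d" using expo_add[OF a', of b e] b de by simp
    qed
    ultimately show ?thesis by (rule span_on_cong[rotated])
  qed
qed

text \<open>The coordinates outside \<open>J\<close> are dropped one by one. No point of
  \<open>X\<close> vanishes on all of \<open>J\<close>, and those coordinates are never altered, so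
  every single projection misses its centre. The second half says that the coordinate ring of
  \<open>X\<close> is generated, as a module over the polynomials in the
  \<open>J\<close>-coordinates, by finitely many monomials.\<close>

theorem finite_projection:
  assumes "finite I" "J \<subseteq> I" "zcone I X" "\<And>x. x \<in> X \<Longrightarrow> \<exists>j\<in>J. x j \<noteq> 0"
  shows "zcone J (restr J ` X) \<and>
    (\<exists>e. \<forall>d. \<forall>a\<in>expo I d. xpow I a \<in> span_on X I {b\<in>expo I d. \<forall>l\<in>I - J. b l < e})"
proof -
  have "finite D \<Longrightarrow> D \<inter> J = {} \<Longrightarrow> zcone (J \<union> D) X \<Longrightarrow> (\<And>x. x \<in> X \<Longrightarrow> \<exists>j\<in>J. x j \<noteq> 0) \<Longrightarrow>
    zcone J (restr J ` X) \<and> (\<exists>e. \<forall>d. \<forall>a\<in>expo (J \<union> D) d.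
      xpow (J \<union> D) a \<in> span_on X (J \<union> D) {b\<in>expo (J \<union> D) d. \<forall>l\<in>D. b l < e})" for D
  proof (induction D arbitrary: X rule: finite_induct)
    case empty
    have finJ: "finite J" using assms finite_subset by blast
    have "restr J x = x" if "x \<in> X" for x
    proof -
      have "x \<in> Pts J" using that empty.prems(2) by (auto simp: zcone_def)
      then show ?thesis by (auto simp: restr_def Pts_def fun_eq_iff)
    qed
    then have "restr J ` X = X" by auto
    then show ?case using empty finite_expo[OF finJ] by (auto intro: span_on_base)
  next
    case (insert k D)
    let ?I = "J \<union> insert k D"
    have I: "finite ?I" "k \<in> ?I" "?I - {k} = J \<union> D" "k \<notin> J"
      using insert.hyps insert.prems assms finite_subset by auto
    define X' where "X' = (\<lambda>x. x(k := 0)) ` X"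
    have hyp: "\<exists>i\<in>?I - {k}. x i \<noteq> 0" if "x \<in> X" for x
      using insert.prems(3)[OF that] I by auto
    have X': "zcone (J \<union> D) X'"
      using projection_zcone[OF I(1,2) insert.prems(2) hyp] I by (simp add: X'_def)
    have nv: "\<exists>j\<in>J. x j \<noteq> 0" if "x \<in> X'" for x
      using that insert.prems(3) I(4) by (fastforce simp: X'_def)
    have DJ: "D \<inter> J = {}" using insert.prems by auto
    obtain e' where e': "\<And>d a. a \<in> expo (J \<union> D) d \<Longrightarrow>
        xpow (J \<union> D) a \<in> span_on X' (J \<union> D) {b\<in>expo (J \<union> D) d. \<forall>l\<in>D. b l < e'}"
      using insert.IH[OF DJ X' nv] by blast
    obtain e c where mc: "c (pure k e) = 1" "\<And>x. x \<in> X \<Longrightarrow> (\<Sum>a\<in>expo ?I e. c a * xpow ?I a x) = 0"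
      using monic_equation[OF I(1,2) insert.prems(2) hyp] by blast
    let ?A = "\<lambda>d. {b\<in>expo ?I d. \<forall>l\<in>insert k D. b l < max e e'}"
    have "xpow ?I a \<in> span_on X ?I (?A d)" if a: "a \<in> expo ?I d" for a d
    \<comment> \<open>The monic equation lowers the exponent at \<open>k\<close>. The remaining
      factor \<open>b'\<close> is a monomial on \<open>X'\<close> and is reduced by the induction
      hypothesis; multiplying back by x_k^(b k) does not disturb the bounds at
      \<open>D\<close>.\<close>
    proof (rule span_on_trans[OF monic_reduction[OF I(1,2) mc a]])
      fix b assume "b \<in> {b \<in> expo ?I d. b k < e}"
      then have b: "b \<in> expo ?I d" "b k < e" by auto
      define b' where "b' = b(k := 0)"
      define d' where "d' = sum b' (J \<union> D)"
      have "sum b' (J \<union> D) = sum b (?I - {k})"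
        unfolding I(3)[symmetric] by (rule sum.cong) (auto simp: b'_def)
      then have d: "d = b k + d'"
        using b(1) sum.remove[OF I(1,2), of b] by (simp add: expo_def d'_def)
      have "b' \<in> expo (J \<union> D) d'" using b(1) by (auto simp: expo_def b'_def d'_def)
      then obtain s where s: "\<And>x. x \<in> X' \<Longrightarrow> xpow (J \<union> D) b' x =
          (\<Sum>a\<in>{b\<in>expo (J \<union> D) d'. \<forall>l\<in>D. b l < e'}. s a * xpow (J \<union> D) a x)"
        using e' unfolding span_on_def by blast
      let ?B = "{b\<in>expo (J \<union> D) d'. \<forall>l\<in>D. b l < e'}"
      have up: "xpow ?I a x = x k ^ a k * xpow (J \<union> D) (a(k := 0)) (x(k := 0))" for a x
      proof -
        have "xpow (J \<union> D) (a(k := 0)) (x(k := 0)) = xpow (J \<union> D) a x"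
          unfolding xpow_def I(3)[symmetric] by (rule prod.cong) auto
        then show ?thesis using xpow_remove[OF I(1,2), of a x] unfolding I(3) by simp
      qed
      have "xpow ?I b x = (\<Sum>a\<in>?B. s a * xpow ?I (a(k := b k)) x)" if "x \<in> X" for x
      proof -
        have "xpow ?I b x = x k ^ b k * xpow (J \<union> D) b' (x(k := 0))"
          using up[of b x] by (simp add: b'_def)
        also have "\<dots> = (\<Sum>a\<in>?B. s a * (x k ^ b k * xpow (J \<union> D) a (x(k := 0))))"
          using s[of "x(k := 0)"] that by (simp add: X'_def sum_distrib_left mult_ac)
        also have "\<dots> = (\<Sum>a\<in>?B. s a * xpow ?I (a(k := b k)) x)"
        proof (rule sum.cong)
          fix a assume "a \<in> ?B"
          then have "a k = 0" using insert.hyps I(4) by (auto simp: expo_def)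
          then have "(a(k := b k))(k := 0) = a" by auto
          then show "s a * (x k ^ b k * xpow (J \<union> D) a (x(k := 0))) = s a * xpow ?I (a(k := b k)) x"
            using up[of "a(k := b k)" x] by simp
        qed simp
        finally show ?thesis .
      qed
      moreover have "(\<lambda>x. \<Sum>a\<in>?B. s a * xpow ?I (a(k := b k)) x) \<in> span_on X ?I (?A d)"
      proof (intro span_on_sum span_on_scale span_on_base)
        show "finite (?A d)" using finite_expo[OF I(1)] by simp
        fix a assume a: "a \<in> ?B"
        have "sum (a(k := b k)) (J \<union> D) = sum a (J \<union> D)"
          unfolding I(3)[symmetric] by (rule sum.cong) auto
        then have "sum (a(k := b k)) ?I = d"
          using sum.remove[OF I(1,2), of "a(k := b k)"] a d unfolding I(3) by (simp add: expo_def)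
        then show "a(k := b k) \<in> ?A d" using a b(2) by (auto simp: expo_def less_max_iff_disj)
      qed
      ultimately show "xpow ?I b \<in> span_on X ?I (?A d)" by (rule span_on_cong[rotated])
    qed
    then have "\<exists>e. \<forall>d. \<forall>a\<in>expo ?I d. xpow ?I a \<in> span_on X ?I {b\<in>expo ?I d. \<forall>l\<in>insert k D. b l < e}"
      by blast
    moreover have "restr J ` X' = restr J ` X"
      unfolding X'_def image_image using I(4)
      by (intro image_cong) (auto simp: restr_def)
    moreover have "zcone J (restr J ` X')" using insert.IH[OF DJ X'] nv by blast
    ultimately show ?case by simp
  qed
  from this[of "I - J"] show ?thesis using assms by (simp add: Un_absorb1 Int_commute[of _ J])
qed

text \<open>The exponent at \<open>j\<close> is determined by the total degree, which is why the
  power is \<open>card J - 1\<close>; the other exponents in \<open>J\<close> are at most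
  \<open>d\<close>, those outside are less than \<open>e\<close>.\<close>

lemma card_reduced_expo:
  assumes "finite I" "J \<subseteq> I" "j \<in> J"
  shows "card {b\<in>expo I d. \<forall>l\<in>I - J. b l < e} \<le> e ^ card (I - J) * (d + 1) ^ (card J - 1)"
proof -
  let ?A = "{b\<in>expo I d. \<forall>l\<in>I - J. b l < e}"
  let ?P = "PiE (I - {j}) (\<lambda>i. if i \<in> J then {..d} else {..<e})"
  have finJ: "finite J" using assms finite_subset by blast
  have "inj_on (\<lambda>b. restrict b (I - {j})) ?A"
  proof (rule inj_onI)
    fix a b assume a: "a \<in> ?A" and b: "b \<in> ?A" and eq: "restrict a (I - {j}) = restrict b (I - {j})"
    have same: "a i = b i" if "i \<in> I - {j}" for i
      using fun_cong[OF eq, of i] that by (simp add: restrict_def split: if_splits)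
    have "sum a I = a j + sum a (I - {j})" "sum b I = b j + sum b (I - {j})"
      using assms by (auto intro: sum.remove)
    moreover have "sum a (I - {j}) = sum b (I - {j})" using same by (rule sum.cong[OF refl])
    ultimately have "a j = b j" using a b by (simp add: expo_def)
    show "a = b"
    proof
      fix i show "a i = b i"
        using same[of i] \<open>a j = b j\<close> a b by (cases "i \<in> I"; cases "i = j") (auto simp: expo_def)
    qed
  qed
  moreover have "(\<lambda>b. restrict b (I - {j})) ` ?A \<subseteq> ?P"
  proof (rule image_subsetI)
    fix b assume b: "b \<in> ?A"
    have "b i \<le> d" if "i \<in> I" for i
      using b that assms(1) by (auto simp: expo_def intro!: member_le_sum)
    then show "restrict b (I - {j}) \<in> ?P" using b unfolding restrict_PiE_iff by auto
  qed
  moreover have "finite ?P" using assms by (intro finite_PiE) auto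
  ultimately have "card ?A \<le> card ?P" by (rule card_inj_on_le)
  also have "card ?P = (\<Prod>i\<in>I - {j}. if i \<in> J then d + 1 else e)"
    using assms by (simp add: card_PiE if_distrib cong: if_cong)
  also have "I - {j} = (J - {j}) \<union> (I - J)" using assms by auto
  also have "(\<Prod>i\<in>(J - {j}) \<union> (I - J). if i \<in> J then d + 1 else e) =
      (\<Prod>i\<in>J - {j}. if i \<in> J then d + 1 else e) * (\<Prod>i\<in>I - J. if i \<in> J then d + 1 else e)"
    using assms finJ by (intro prod.union_disjoint) auto
  also have "(\<Prod>i\<in>J - {j}. if i \<in> J then d + 1 else e) = (\<Prod>i\<in>J - {j}. d + 1)"
    by (rule prod.cong) auto
  also have "(\<Prod>i\<in>I - J. if i \<in> J then d + 1 else e) = (\<Prod>i\<in>I - J. e)"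
    by (rule prod.cong) auto
  finally show ?thesis using assms by (simp add: mult.commute)
qed

section \<open>Lengths of chains of irreducible sets\<close>

text \<open>Gaussian elimination: equation \<open>a\<close> with pivot \<open>j\<close> removes the
  unknown \<open>j\<close> from all other equations, leaving one equation and one unknown
  less.\<close>

lemma homogeneous_system_solution:
  fixes m :: "'b \<Rightarrow> 'c \<Rightarrow> 'a::field"
  assumes "finite A" "finite B" "card A < card B"
  shows "\<exists>c. (\<exists>i\<in>B. c i \<noteq> 0) \<and> (\<forall>b\<in>A. (\<Sum>i\<in>B. c i * m b i) = 0)"
  using assms
proof (induction A arbitrary: B m rule: finite_induct)
  case empty
  then show ?case by (intro exI[of _ "\<lambda>_. 1"]) (auto simp: card_gt_0_iff)
next
  case (insert a A)
  show ?case
  proof (cases "\<forall>i\<in>B. m a i = 0")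
    case True
    obtain c where "\<exists>i\<in>B. c i \<noteq> 0" "\<forall>b\<in>A. (\<Sum>i\<in>B. c i * m b i) = 0"
      using insert.IH[of B m] insert.prems insert.hyps by auto
    then show ?thesis using True by (intro exI[of _ c]) auto
  next
    case False
    then obtain j where j: "j \<in> B" "m a j \<noteq> 0" by blast
    define m' where "m' b i = m b i - m b j * m a i / m a j" for b i
    obtain c where c: "\<exists>i\<in>B - {j}. c i \<noteq> 0" "\<forall>b\<in>A. (\<Sum>i\<in>B - {j}. c i * m' b i) = 0"
      using insert.IH[of "B - {j}" m'] insert.prems insert.hyps j
      by (auto simp: less_diff_conv)
    define s where "s = (\<Sum>i\<in>B - {j}. c i * m a i)"
    \<comment> \<open>The value of the unknown \<open>j\<close> that equation \<open>a\<close>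
      forces.\<close>
    define c' where "c' = c(j := - s / m a j)"
    have sum': "(\<Sum>i\<in>B. c' i * m b i) = (\<Sum>i\<in>B - {j}. c i * m b i) - s / m a j * m b j" for b
    proof -
      have "(\<Sum>i\<in>B. c' i * m b i) = c' j * m b j + (\<Sum>i\<in>B - {j}. c' i * m b i)"
        using j insert.prems by (intro sum.remove) auto
      also have "(\<Sum>i\<in>B - {j}. c' i * m b i) = (\<Sum>i\<in>B - {j}. c i * m b i)"
        by (rule sum.cong) (auto simp: c'_def)
      finally show ?thesis by (simp add: c'_def)
    qed
    have "(\<Sum>i\<in>B. c' i * m b i) = 0" if "b \<in> insert a A" for b
    proof (cases "b = a")
      case True
      then show ?thesis using j sum'[of a] by (simp add: s_def)
    next
      case False
      then have "(\<Sum>i\<in>B - {j}. c i * m' b i) = 0" using c that by auto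
      moreover have "(\<Sum>i\<in>B - {j}. c i * m' b i) = (\<Sum>i\<in>B - {j}. c i * m b i) - s / m a j * m b j"
        by (simp add: m'_def s_def right_diff_distrib sum_subtractf sum_distrib_left
            sum_distrib_right sum_divide_distrib mult_ac)
      ultimately show ?thesis using sum' by simp
    qed
    moreover have "\<exists>i\<in>B. c' i \<noteq> 0" using c(1) by (auto simp: c'_def)
    ultimately show ?thesis by blast
  qed
qed

text \<open>A lower bound \<open>n\<close> for the Hilbert function of \<open>S\<close> in degree
  \<open>d\<close>, stated without forming the coordinate ring.\<close>

definition indep_forms :: "'i set \<Rightarrow> ('i \<Rightarrow> complex) set \<Rightarrow> nat \<Rightarrow> nat \<Rightarrow> bool" where
  "indep_forms I S d n \<longleftrightarrow> (\<exists>F. (\<forall>i<n. F i \<in> forms I d) \<and>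
     (\<forall>c. (\<forall>x\<in>S. (\<Sum>i<n. c i * F i x) = 0) \<longrightarrow> (\<forall>i<n. c i = 0)))"

lemma indep_forms_mono:
  assumes "indep_forms I S d n" "m \<le> n"
  shows "indep_forms I S d m"
proof -
  obtain F where F: "\<forall>i<n. F i \<in> forms I d"
    "\<And>c. (\<forall>x\<in>S. (\<Sum>i<n. c i * F i x) = 0) \<Longrightarrow> (\<forall>i<n. c i = 0)"
    using assms(1) by (auto simp: indep_forms_def)
  have "\<forall>i<m. c i = 0" if c: "\<forall>x\<in>S. (\<Sum>i<m. c i * F i x) = 0" for c
  proof -
    define c' where "c' i = (if i < m then c i else 0)" for i
    have "(\<Sum>i<n. c' i * F i x) = (\<Sum>i<m. c' i * F i x)" for x
      using assms(2) by (intro sum.mono_neutral_right) (auto simp: c'_def)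
    then have "\<forall>x\<in>S. (\<Sum>i<n. c' i * F i x) = 0" using c by (simp add: c'_def)
    then have "\<forall>i<n. c' i = 0" by (rule F(2))
    then have "\<forall>i<m. c' i = 0" using assms(2) by simp
    then show ?thesis by (simp add: c'_def)
  qed
  then show ?thesis using F(1) assms(2) unfolding indep_forms_def by (intro exI[of _ F]) auto
qed

text \<open>Expressing more forms than there are monomials in \<open>A\<close> through these
  monomials leads to a homogeneous system with more unknowns than equations, hence to a nontrivial
  relation on \<open>S\<close>.\<close>

lemma indep_forms_le_spanning:
  assumes "indep_forms I S d n" "finite A" "\<And>a. a \<in> expo I d \<Longrightarrow> xpow I a \<in> span_on S I A"
  shows "n \<le> card A"
proof (rule ccontr)
  assume "\<not> n \<le> card A"
  obtain F where F: "\<forall>i<n. F i \<in> forms I d"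
    "\<And>c. (\<forall>x\<in>S. (\<Sum>i<n. c i * F i x) = 0) \<Longrightarrow> (\<forall>i<n. c i = 0)"
    using assms(1) by (auto simp: indep_forms_def)
  have "F i \<in> span_on S I A" if "i < n" for i
  proof -
    obtain c where "F i = (\<lambda>x. \<Sum>a\<in>expo I d. c a * xpow I a x)"
      using F(1) \<open>i < n\<close> by (auto simp: forms_def)
    then show ?thesis by (auto intro!: span_on_sum span_on_scale assms(3))
  qed
  then have "\<forall>i\<in>{..<n}. \<exists>m. \<forall>x\<in>S. F i x = (\<Sum>b\<in>A. m b * xpow I b x)"
    by (auto simp: span_on_def)
  then obtain m where m: "\<And>i x. i < n \<Longrightarrow> x \<in> S \<Longrightarrow> F i x = (\<Sum>b\<in>A. m i b * xpow I b x)"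
    by (metis lessThan_iff)
  obtain c where c: "\<exists>i\<in>{..<n}. c i \<noteq> 0" "\<forall>b\<in>A. (\<Sum>i\<in>{..<n}. c i * m i b) = 0"
    using homogeneous_system_solution[of A "{..<n}" "\<lambda>b i. m i b"] assms(2) \<open>\<not> n \<le> card A\<close>
    by auto
  have "(\<Sum>i<n. c i * F i x) = 0" if "x \<in> S" for x
  proof -
    have "(\<Sum>i<n. c i * F i x) = (\<Sum>i<n. \<Sum>b\<in>A. c i * m i b * xpow I b x)"
      using m that by (simp add: sum_distrib_left mult.assoc)
    also have "\<dots> = (\<Sum>b\<in>A. (\<Sum>i<n. c i * m i b) * xpow I b x)"
      by (subst sum.swap) (simp add: sum_distrib_right)
    finally show ?thesis using c(2) by simp
  qed
  then show False using F(2) c(1) by blast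
qed

text \<open>The homogeneous ideal of \<open>S\<close> is prime. \<open>S\<close> may be any set, so
  the notion applies to images under multiplication before their closure is taken.\<close>

definition prime_cone :: "'i set \<Rightarrow> ('i \<Rightarrow> complex) set \<Rightarrow> bool" where
  "prime_cone I S \<longleftrightarrow> S \<noteq> {} \<and> (\<forall>d e f g. f \<in> forms I d \<and> g \<in> forms I e \<and>
     (\<forall>x\<in>S. f x * g x = 0) \<longrightarrow> (\<forall>x\<in>S. f x = 0) \<or> (\<forall>x\<in>S. g x = 0))"

lemma prime_coneD:
  assumes "prime_cone I S" "f \<in> forms I d" "g \<in> forms I e"
    "x \<in> S" "f x \<noteq> 0" "y \<in> S" "g y \<noteq> 0"
  obtains z where "z \<in> S" "f z \<noteq> 0" "g z \<noteq> 0"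
proof (rule ccontr)
  assume "\<not> thesis"
  then have "\<forall>z\<in>S. f z * g z = 0" using that by auto
  then have "(\<forall>x\<in>S. f x = 0) \<or> (\<forall>x\<in>S. g x = 0)"
    using assms(1-3) unfolding prime_cone_def by blast
  then show False using assms(4-7) by blast
qed

text \<open>Products of $f$ with independent forms on $S$, together with forms that are
  independent on the subset $Z$ where $f$ vanishes.\<close>

lemma indep_forms_extend:
  assumes "finite I" "prime_cone I S" "Z \<subseteq> S" "f \<in> forms I e"
    and "\<And>x. x \<in> Z \<Longrightarrow> f x = 0" "s \<in> S" "f s \<noteq> 0"
    and "indep_forms I S d n" "indep_forms I Z (d + e) m"
  shows "indep_forms I S (d + e) (n + m)"
proof -
  obtain F where F: "\<And>i. i < n \<Longrightarrow> F i \<in> forms I d"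
    "\<And>c. (\<forall>x\<in>S. (\<Sum>i<n. c i * F i x) = 0) \<Longrightarrow> (\<forall>i<n. c i = 0)"
    using assms(8) by (auto simp: indep_forms_def)
  obtain H where H: "\<And>i. i < m \<Longrightarrow> H i \<in> forms I (d + e)"
    "\<And>c. (\<forall>x\<in>Z. (\<Sum>i<m. c i * H i x) = 0) \<Longrightarrow> (\<forall>i<m. c i = 0)"
    using assms(9) by (auto simp: indep_forms_def)
  define G where "G i = (if i < n then (\<lambda>x. F i x * f x) else H (i - n))" for i
  have "\<forall>i<n + m. G i \<in> forms I (d + e)"
    using F(1) H(1) by (auto simp: G_def intro: forms_mult[OF assms(1)] assms(4))
  moreover have "\<forall>i<n + m. c i = 0" if c: "\<forall>x\<in>S. (\<Sum>i<n + m. c i * G i x) = 0" for c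
  proof -
    have split: "(\<Sum>i<n + m. c i * G i x) = (\<Sum>i<n. c i * F i x) * f x + (\<Sum>i<m. c (n + i) * H i x)" for x
    proof -
      have "(\<Sum>i<n + m. c i * G i x) = (\<Sum>i<n. c i * G i x) + (\<Sum>i = n..<n + m. c i * G i x)"
        unfolding lessThan_atLeast0 by (rule sum.atLeastLessThan_concat[symmetric]) auto
      also have "(\<Sum>i = n..<n + m. c i * G i x) = (\<Sum>i<m. c (n + i) * G (n + i) x)"
        using sum.shift_bounds_nat_ivl[of "\<lambda>i. c i * G i x" 0 n m]
        by (simp add: lessThan_atLeast0 add.commute)
      finally show ?thesis by (simp add: G_def sum_distrib_right mult.assoc)
    qed
    \<comment> \<open>On \<open>Z\<close> the first summand vanishes with \<open>f\<close>, which
      isolates the combination of the \<open>H i\<close>.\<close>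
    have "\<forall>x\<in>Z. (\<Sum>i<m. c (n + i) * H i x) = 0"
      using c split assms(3,5) by force
    then have c2: "\<forall>i<m. c (n + i) = 0" by (rule H(2)[of "\<lambda>i. c (n + i)"])
    have form: "(\<lambda>x. \<Sum>i<n. c i * F i x) \<in> forms I d"
      by (intro forms_sum forms_scale F(1)) simp
    \<comment> \<open>Primality cancels the factor \<open>f\<close>, which is nonzero at
      \<open>s\<close>.\<close>
    have "(\<Sum>i<n. c i * F i x) = 0" if "x \<in> S" for x
    proof (rule ccontr)
      assume "(\<Sum>i<n. c i * F i x) \<noteq> 0"
      then obtain z where "z \<in> S" "(\<Sum>i<n. c i * F i z) \<noteq> 0" "f z \<noteq> 0"
        using prime_coneD[OF assms(2) form assms(4) \<open>x \<in> S\<close> _ assms(6,7)] by blast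
      moreover have "(\<Sum>i<m. c (n + i) * H i z) = 0" using c2 by simp
      ultimately show False using c split by auto
    qed
    then have c1: "\<forall>i<n. c i = 0" using F(2) by blast
    show ?thesis
    proof (intro allI impI)
      fix i assume "i < n + m"
      then show "c i = 0" using c1 c2[rule_format, of "i - n"] by (cases "i < n") auto
    qed
  qed
  ultimately show ?thesis unfolding indep_forms_def by blast
qed

lemma Pts_nonzero_coord: "x \<in> Pts I \<Longrightarrow> \<exists>i\<in>I. x i \<noteq> 0"
  unfolding Pts_def fun_eq_iff by blast

lemma indep_forms_single:
  assumes "finite I" "S \<subseteq> Pts I" "S \<noteq> {}"
  shows "indep_forms I S d 1"
proof -
  obtain s where "s \<in> S" using assms(3) by blast
  moreover obtain i where "i \<in> I" "s i \<noteq> 0"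
    using \<open>s \<in> S\<close> assms(2) Pts_nonzero_coord by blast
  ultimately have s: "s \<in> S" "i \<in> I" "s i \<noteq> 0" .
  have "(\<lambda>x. x i ^ d) \<in> forms I d"
    using forms_power[OF assms(1) forms_coord[OF assms(1) s(2)], of d] by simp
  then show ?thesis using s unfolding indep_forms_def
    by (intro exI[of _ "\<lambda>_ x. x i ^ d"]) auto
qed

text \<open>If $f_j$ vanishes on $Z_{j-1}$ but not on $Z_j$, all of the same degree, these are the
  monomials in $f_0, \dots, f_k$.\<close>

lemma indep_forms_chain:
  assumes "finite I" "\<And>i. i \<le> k \<Longrightarrow> zcone I (Z i) \<and> prime_cone I (Z i)"
    and "\<And>i. i < k \<Longrightarrow> Z i \<subset> Z (Suc i)"
  shows "\<exists>E>0. \<forall>d. indep_forms I (Z k) (d * E) ((d + k) choose k)"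
  using assms(2,3)
proof (induction k)
  case 0
  then have "Z 0 \<subseteq> Pts I" "Z 0 \<noteq> {}" by (auto simp: zcone_def prime_cone_def)
  then show ?case using indep_forms_single[OF assms(1)] by (intro exI[of _ 1]) auto
next
  case (Suc k)
  obtain E where E: "E > 0" "\<And>d. indep_forms I (Z k) (d * E) ((d + k) choose k)"
    using Suc.IH Suc.prems by (metis le_SucI less_SucI)
  have sub: "Z k \<subset> Z (Suc k)" using Suc by simp
  have zc: "zcone I (Z k)" "zcone I (Z (Suc k))" "prime_cone I (Z (Suc k))" using Suc by auto
  obtain s where s: "s \<in> Z (Suc k)" "s \<notin> Z k" using sub by blast
  then have "s \<in> Pts I" using zc by (auto simp: zcone_def)
  then obtain e f where f: "f \<in> forms I e" "\<And>y. y \<in> Z k \<Longrightarrow> f y = 0" "f s \<noteq> 0"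
    using zcone_separate[OF zc(1) _ s(2)] by blast
  have ne: "Z k \<noteq> {}" using Suc by (auto simp: prime_cone_def)
  \<comment> \<open>A form of degree 0 is constant and would vanish at \<open>s\<close> as it does
    on the nonempty \<open>Z k\<close>.\<close>
  have "e > 0"
  proof (rule ccontr)
    assume "\<not> e > 0"
    then have "f x = f (\<lambda>_. 0)" for x
      using forms_homogeneous[OF assms(1) f(1), of 0 x] by simp
    then show False using f(2,3) ne by (metis ex_in_conv)
  qed
  \<comment> \<open>The induction hypothesis speaks only of degrees divisible by \<open>E\<close>,
    so the separating form is replaced by its \<open>E\<close>-th power. The degree
    \<open>e * E\<close> of that power is the new \<open>E\<close>.\<close>
  have pow: "(\<lambda>x. f x ^ E) \<in> forms I (e * E)"
    using forms_power[OF assms(1) f(1), of E] by (simp add: mult.commute)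
  \<comment> \<open>Pascal's rule: multiples of f^E contribute the count for \<open>d\<close>, and
    forms independent on \<open>Z k\<close> contribute (Suc d + k choose k).\<close>
  have "indep_forms I (Z (Suc k)) (d * (e * E)) ((d + Suc k) choose Suc k)" for d
  proof (induction d)
    case 0
    then show ?case
      using indep_forms_single[OF assms(1), of "Z (Suc k)" 0] zc by (auto simp: zcone_def prime_cone_def)
  next
    case (Suc d)
    have "(Suc d + k) choose k \<le> (Suc d * e + k) choose k"
      using mult_le_mono2[of 1 e "Suc d"] \<open>e > 0\<close> by (intro binomial_right_mono) simp
    moreover have "indep_forms I (Z k) (d * (e * E) + e * E) ((Suc d * e + k) choose k)"
      using E(2)[of "Suc d * e"] by (simp add: algebra_simps)
    ultimately have "indep_forms I (Z k) (d * (e * E) + e * E) ((Suc d + k) choose k)"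
      using indep_forms_mono by blast
    then have "indep_forms I (Z (Suc k)) (d * (e * E) + e * E)
        (((d + Suc k) choose Suc k) + ((Suc d + k) choose k))"
      using indep_forms_extend[OF assms(1) zc(3) _ pow _ s(1) _ Suc.IH] sub f E(1) by auto
    then show ?case by (simp add: algebra_simps)
  qed
  then show ?case using \<open>e > 0\<close> E(1) by (intro exI[of _ "e * E"]) simp
qed

theorem chain_length_bound:
  assumes "finite I" "J \<subseteq> I" "j \<in> J"
    and "\<And>i. i \<le> k \<Longrightarrow> zcone I (Z i) \<and> prime_cone I (Z i)"
    and "\<And>i. i < k \<Longrightarrow> Z i \<subset> Z (Suc i)"
    and "\<And>x. x \<in> Z k \<Longrightarrow> \<exists>j\<in>J. x j \<noteq> 0"
  shows "k \<le> card J - 1"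
proof (rule ccontr)
  assume "\<not> k \<le> card J - 1"
  then obtain r where r: "r = card J - 1" "Suc r \<le> k" by simp
  obtain E where E: "\<And>d. indep_forms I (Z k) (d * E) ((d + k) choose k)"
    using indep_forms_chain[of I k Z] assms(1,4,5) by blast
  obtain e where e: "\<And>d a. a \<in> expo I d \<Longrightarrow>
      xpow I a \<in> span_on (Z k) I {b\<in>expo I d. \<forall>l\<in>I - J. b l < e}"
    using finite_projection[of I J "Z k"] assms(1,2,4,6) by blast
  define M where "M = e ^ card (I - J)"
  have bound: "(d + k) choose k \<le> M * (d * E + 1) ^ r" for d
  proof -
    have "(d + k) choose k \<le> card {b\<in>expo I (d * E). \<forall>l\<in>I - J. b l < e}"
      by (rule indep_forms_le_spanning[OF E _ e]) (use finite_expo[OF assms(1)] in simp)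
    also have "\<dots> \<le> M * (d * E + 1) ^ r"
      using card_reduced_expo[OF assms(1-3), of "d * E" e] by (simp add: M_def r)
    finally show ?thesis .
  qed
  \<comment> \<open>From k^k (d + k choose k) >= d^k and \<open>bound\<close> one gets d^(r + 1) <=
    k^k M (E + 1)^r d^r for every d >= 1; this \<open>d\<close> is one too large for that.\<close>
  define d where "d = k ^ k * M * (E + 1) ^ r + 1"
  have k: "k > 0" using r by simp
  have "d ^ Suc r \<le> d ^ k" using r by (intro power_increasing) (auto simp: d_def)
  also have "d ^ k \<le> k ^ k * ((d + k) choose k)"
  proof -
  have "real (d ^ k) \<le> real (k ^ k * ((d + k) choose k))"
  proof -
    have "(real d / real k) ^ k \<le> (real (d + k) / real k) ^ k"
      by (intro power_mono divide_right_mono) auto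
    also have "\<dots> \<le> real ((d + k) choose k)"
      using binomial_ge_n_over_k_pow_k[of k "d + k", where 'a=real] by simp
    finally show ?thesis using k by (simp add: power_divide field_simps)
  qed
  then show ?thesis by linarith
  qed
  also have "\<dots> \<le> k ^ k * (M * (d * E + 1) ^ r)" using bound by (intro mult_left_mono) auto
  also have "\<dots> \<le> k ^ k * (M * (d * (E + 1)) ^ r)"
    by (intro mult_left_mono power_mono) (auto simp: d_def)
  also have "\<dots> = (k ^ k * M * (E + 1) ^ r) * d ^ r" by (simp only: power_mult_distrib mult_ac)
  finally have "d * d ^ r \<le> (k ^ k * M * (E + 1) ^ r) * d ^ r" by simp
  then have "d \<le> k ^ k * M * (E + 1) ^ r" by (simp add: d_def)
  then show False by (simp add: d_def)
qed

section \<open>Hadamard products of closed cones\<close>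

lemma PtsI: "(\<And>i. i \<notin> I \<Longrightarrow> x i = 0) \<Longrightarrow> x k \<noteq> 0 \<Longrightarrow> x \<in> Pts I"
  by (auto simp: Pts_def)

definition segre :: "('i \<Rightarrow> complex) set \<Rightarrow> ('i \<Rightarrow> complex) set \<Rightarrow> ('i \<times> 'i \<Rightarrow> complex) set" where
  "segre X Y = {m. \<exists>p\<in>X. \<exists>q\<in>Y. m = (\<lambda>(i, j). p i * q j)}"

text \<open>Let a matrix satisfy all equations of the Segre variety and have a nonzero entry (k, l).
  Its 2 x 2 minors make it the product of column \<open>l\<close> and row \<open>k\<close> divided
  by that entry; the equations of \<open>X\<close> and \<open>Y\<close>, read on column
  \<open>l\<close> and row \<open>k\<close>, put these vectors into \<open>X\<close> and
  \<open>Y\<close>.\<close>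

lemma zcone_segre:
  assumes "finite I" "zcone I X" "zcone I Y"
  shows "zcone (I \<times> I) (segre X Y)"
proof (rule zconeI)
  show "segre X Y \<subseteq> Pts (I \<times> I)"
  proof
    fix m assume "m \<in> segre X Y"
    then obtain p q where m: "p \<in> X" "q \<in> Y" "m = (\<lambda>(i, j). p i * q j)" by (auto simp: segre_def)
    then have pq: "p \<in> Pts I" "q \<in> Pts I" using assms by (auto simp: zcone_def)
    then obtain i j where "p i \<noteq> 0" "q j \<noteq> 0" using Pts_nonzero_coord by blast
    then have nz: "m (i, j) \<noteq> 0" by (simp add: m)
    have "m ij = 0" if "ij \<notin> I \<times> I" for ij
      using that pq by (cases ij) (auto simp: m Pts_def)
    then show "m \<in> Pts (I \<times> I)" using nz by (rule PtsI)
  qed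
  have fin: "finite (I \<times> I)" using assms by simp
  fix m assume m: "m \<in> Pts (I \<times> I)"
    and van: "\<And>d f. f \<in> forms (I \<times> I) d \<Longrightarrow> (\<And>y. y \<in> segre X Y \<Longrightarrow> f y = 0) \<Longrightarrow> f m = 0"
  obtain k l where kl: "k \<in> I" "l \<in> I" "m (k, l) \<noteq> 0" using Pts_nonzero_coord[OF m] by auto
  define p where "p i = m (i, l)" for i
  define q where "q j = m (k, j)" for j
  have supp: "m (i, j) = 0" if "i \<notin> I \<or> j \<notin> I" for i j using m that by (auto simp: Pts_def)
  have "p k \<noteq> 0" "q l \<noteq> 0" using kl by (auto simp: p_def q_def)
  have "p \<in> X"
  proof (rule zconeD[OF assms(2)])
    show "p \<in> Pts I" by (rule PtsI[of _ _ k]) (use supp \<open>p k \<noteq> 0\<close> in \<open>auto simp: p_def\<close>)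
    fix d f assume f: "f \<in> forms I d" "\<And>y. y \<in> X \<Longrightarrow> f y = 0"
    have "(\<lambda>m. f (\<lambda>i. m (i, l))) \<in> forms (I \<times> I) d"
      by (rule forms_linear_subst[OF assms(1) fin f(1)]) (rule forms_coord[OF fin], use kl in simp)
    moreover have "f (\<lambda>i. y (i, l)) = 0" if "y \<in> segre X Y" for y
    proof -
      obtain p q where y: "p \<in> X" "y = (\<lambda>(i, j). p i * q j)" using \<open>y \<in> segre X Y\<close> by (auto simp: segre_def)
      show ?thesis using forms_homogeneous[OF assms(1) f(1), of "q l" p] f(2)[OF y(1)]
        by (simp add: y(2) mult.commute)
    qed
    ultimately show "f p = 0" using van unfolding p_def by blast
  qed
  have "q \<in> Y"
  proof (rule zconeD[OF assms(3)])
    show "q \<in> Pts I" by (rule PtsI[of _ _ l]) (use supp \<open>q l \<noteq> 0\<close> in \<open>auto simp: q_def\<close>)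
    fix d f assume f: "f \<in> forms I d" "\<And>y. y \<in> Y \<Longrightarrow> f y = 0"
    have "(\<lambda>m. f (\<lambda>j. m (k, j))) \<in> forms (I \<times> I) d"
      by (rule forms_linear_subst[OF assms(1) fin f(1)]) (rule forms_coord[OF fin], use kl in simp)
    moreover have "f (\<lambda>j. y (k, j)) = 0" if "y \<in> segre X Y" for y
    proof -
      obtain p q where y: "q \<in> Y" "y = (\<lambda>(i, j). p i * q j)" using \<open>y \<in> segre X Y\<close> by (auto simp: segre_def)
      show ?thesis using forms_homogeneous[OF assms(1) f(1), of "p k" q] f(2)[OF y(1)]
        by (simp add: y(2))
    qed
    ultimately show "f q = 0" using van unfolding q_def by blast
  qed
  have minor: "m (i, j) * m (k, l) = m (i, l) * m (k, j)" for i j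
  proof (cases "i \<in> I \<and> j \<in> I")
    case True
    let ?f = "\<lambda>m. m (i, j) * m (k, l) + (-1) * (m (i, l) * m (k, j))"
    have "?f m = 0"
    proof (rule van)
      have "?f \<in> forms (I \<times> I) (1 + 1)"
        by (intro forms_add forms_scale forms_mult fin forms_coord) (use True kl in auto)
      then show "?f \<in> forms (I \<times> I) (1 + 1)" .
    qed (auto simp: segre_def)
    then show ?thesis by simp
  qed (use supp in auto)
  \<comment> \<open>The scalar is absorbed into the row, which stays in the cone
    \<open>Y\<close>.\<close>
  define s where "s = 1 / m (k, l)"
  have "(\<lambda>j. s * q j) \<in> Y"
    by (rule zcone_scale[OF assms(1,3) \<open>q \<in> Y\<close>]) (use kl in \<open>simp add: s_def\<close>)
  moreover have "m = (\<lambda>(i, j). p i * (s * q j))"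
  proof
    fix ij show "m ij = (case ij of (i, j) \<Rightarrow> p i * (s * q j))"
      using minor[of "fst ij" "snd ij"] kl(3)
      by (cases ij) (simp add: s_def p_def q_def field_simps)
  qed
  ultimately show "m \<in> segre X Y" using \<open>p \<in> X\<close>
    unfolding segre_def by (intro CollectI bexI[of _ p] bexI[of _ "\<lambda>j. s * q j"])
qed

text \<open>The Hadamard product is the linear projection of the Segre variety to the diagonal
  coordinates; by assumption the centre of the projection misses it.\<close>

lemma zcone_hprod:
  assumes "finite I" "zcone I X" "zcone I Y"
    and "\<And>p q. p \<in> X \<Longrightarrow> q \<in> Y \<Longrightarrow> hprod p q \<in> Pts I"
  shows "zcone I {hprod p q | p q. p \<in> X \<and> q \<in> Y}"
proof (rule zconeI)
  let ?S = "{hprod p q | p q. p \<in> X \<and> q \<in> Y}"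
  show "?S \<subseteq> Pts I" using assms(4) by blast
  define J where "J = (\<lambda>i. (i, i)) ` I"
  have J: "J \<subseteq> I \<times> I" "finite (I \<times> I)" "finite J" using assms(1) by (auto simp: J_def)
  have "\<exists>j\<in>J. m j \<noteq> 0" if m: "m \<in> segre X Y" for m
  proof -
    obtain p q where pq: "p \<in> X" "q \<in> Y" "m = (\<lambda>(i, j). p i * q j)"
      using m by (auto simp: segre_def)
    obtain i where "i \<in> I" "hprod p q i \<noteq> 0" using Pts_nonzero_coord[OF assms(4)[OF pq(1,2)]] by blast
    then show ?thesis by (auto simp: J_def pq hprod_def)
  qed
  then have im: "zcone J (restr J ` segre X Y)"
    using finite_projection[OF J(2,1) zcone_segre[OF assms(1-3)]] by blast
  fix z assume z: "z \<in> Pts I"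
    and van: "\<And>d f. f \<in> forms I d \<Longrightarrow> (\<And>y. y \<in> ?S \<Longrightarrow> f y = 0) \<Longrightarrow> f z = 0"
  define diag where "diag z = (\<lambda>(i, j). if i = j then z i else 0 :: complex)" for z :: "nat \<Rightarrow> complex"
  have diag: "restr J (\<lambda>(i, j). p i * q j) = diag (hprod p q)" if "p \<in> X" for p q
  proof
    fix ij
    have "p i = 0" if "i \<notin> I" for i using that \<open>p \<in> X\<close> assms(2) by (auto simp: zcone_def Pts_def)
    then show "restr J (\<lambda>(i, j). p i * q j) ij = diag (hprod p q) ij"
      by (cases ij) (auto simp: restr_def diag_def hprod_def J_def)
  qed
  \<comment> \<open>A form in the diagonal entries is a form in \<open>z\<close>, so
    \<open>diag z\<close> satisfies all equations of the closed image because \<open>z\<close>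
    satisfies all equations of the set of products.\<close>
  have "diag z \<in> restr J ` segre X Y"
  proof (rule zconeD[OF im])
    obtain i where i: "z i \<noteq> 0" using Pts_nonzero_coord[OF z] by blast
    have "diag z ij = 0" if "ij \<notin> J" for ij
      using that z by (cases ij) (auto simp: diag_def J_def Pts_def)
    moreover have "diag z (i, i) \<noteq> 0" using i by (simp add: diag_def)
    ultimately show "diag z \<in> Pts J" by (rule PtsI)
    fix d f assume f: "f \<in> forms J d" "\<And>y. y \<in> restr J ` segre X Y \<Longrightarrow> f y = 0"
    have "(\<lambda>z. f (\<lambda>ij. diag z ij)) \<in> forms I d"
    proof (rule forms_linear_subst[OF J(3) assms(1) f(1)])
      fix ij assume "ij \<in> J"
      then obtain i where "i \<in> I" "ij = (i, i)" by (auto simp: J_def)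
      then show "(\<lambda>z. diag z ij) \<in> forms I 1" using forms_coord[OF assms(1)] by (simp add: diag_def)
    qed
    then have "f (\<lambda>ij. diag z ij) = 0"
    proof (rule van)
      fix y assume "y \<in> ?S"
      then obtain p q where pq: "p \<in> X" "q \<in> Y" "y = hprod p q" by blast
      have "diag y \<in> restr J ` segre X Y"
        using pq diag[OF pq(1), of q] unfolding segre_def by (metis (mono_tags, lifting) imageI mem_Collect_eq)
      then show "f (\<lambda>ij. diag y ij) = 0" by (rule f(2))
    qed
    then show "f (diag z) = 0" .
  qed
  then obtain p q where pq: "p \<in> X" "q \<in> Y" "diag z = diag (hprod p q)"
    using diag by (auto simp: segre_def)
  have "z i = hprod p q i" for i using fun_cong[OF pq(3), of "(i, i)"] by (simp add: diag_def)
  then show "z \<in> ?S" using pq by blast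
qed

section \<open>Irreducibility of products, points, projective space and closures\<close>

lemma form_hprod:
  assumes "finite I" "f \<in> forms I d"
  shows "(\<lambda>q. f (hprod p q)) \<in> forms I d"
  unfolding hprod_def
  by (rule forms_linear_subst[OF assms(1,1,2)]) (intro forms_scale forms_coord[OF assms(1)])

lemma hprod_commute: "hprod p q = hprod q p"
  by (simp add: hprod_def mult.commute)

lemma hprod_assoc: "hprod (hprod p q) r = hprod p (hprod q r)"
  by (simp add: hprod_def mult.assoc)

text \<open>The factors are chosen one at a time: with \<open>q\<close> and \<open>q'\<close> fixed,
  primality of \<open>X\<close> gives one \<open>u\<close> good for both forms; with this
  \<open>u\<close> fixed, primality of \<open>Y\<close> gives one \<open>v\<close>.\<close>

lemma prime_cone_hprod:
  assumes "finite I" "prime_cone I X" "prime_cone I Y"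
  shows "prime_cone I {hprod p q | p q. p \<in> X \<and> q \<in> Y}"
proof -
  let ?S = "{hprod p q | p q. p \<in> X \<and> q \<in> Y}"
  have "(\<forall>x\<in>?S. f x = 0) \<or> (\<forall>x\<in>?S. g x = 0)"
    if fg: "f \<in> forms I d" "g \<in> forms I e" "\<forall>x\<in>?S. f x * g x = 0" for d e f g
  proof (rule ccontr)
    assume "\<not> ?thesis"
    then obtain p q p' q' where pq: "p \<in> X" "q \<in> Y" "f (hprod p q) \<noteq> 0"
      "p' \<in> X" "q' \<in> Y" "g (hprod p' q') \<noteq> 0" by blast
    have f1: "(\<lambda>p. f (hprod p q)) \<in> forms I d" "(\<lambda>p. g (hprod p q')) \<in> forms I e"
      using form_hprod[OF assms(1) fg(1), of q] form_hprod[OF assms(1) fg(2), of q']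
      by (simp_all add: hprod_commute)
    obtain u where u: "u \<in> X" "f (hprod u q) \<noteq> 0" "g (hprod u q') \<noteq> 0"
      using prime_coneD[of I X "\<lambda>p. f (hprod p q)" d "\<lambda>p. g (hprod p q')" e p p'] assms(2) f1 pq
      by blast
    obtain v where v: "v \<in> Y" "f (hprod u v) \<noteq> 0" "g (hprod u v) \<noteq> 0"
      using prime_coneD[of I Y "\<lambda>q. f (hprod u q)" d "\<lambda>q. g (hprod u q)" e q q'] assms(3) pq u
        form_hprod[OF assms(1) fg(1)] form_hprod[OF assms(1) fg(2)] by blast
    then show False using fg(3) u(1) by auto
  qed
  moreover have "?S \<noteq> {}" using assms by (auto simp: prime_cone_def)
  ultimately show ?thesis unfolding prime_cone_def by blast
qed

lemma prime_cone_line: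
  assumes "finite I"
  shows "prime_cone I {\<lambda>i. c * u i | c. c \<noteq> 0}"
proof -
  let ?S = "{\<lambda>i. c * u i | c. c \<noteq> 0}"
  have u: "u \<in> ?S" by (intro CollectI exI[of _ 1]) simp
  have zero: "\<forall>x\<in>?S. f x = 0" if "f \<in> forms I d" "f u = 0" for f d
    using forms_homogeneous[OF assms that(1)] that(2) by auto
  have "(\<forall>x\<in>?S. f x = 0) \<or> (\<forall>x\<in>?S. g x = 0)"
    if fg: "f \<in> forms I d" "g \<in> forms I e" "\<forall>x\<in>?S. f x * g x = 0" for d e f g
  proof -
    have "f u = 0 \<or> g u = 0" using fg(3) u by auto
    then show ?thesis using zero[OF fg(1)] zero[OF fg(2)] by blast
  qed
  then show ?thesis using u unfolding prime_cone_def by blast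
qed

text \<open>On the line through a point with f \<noteq> 0 and a point with g \<noteq> 0, both forms
  become nonzero one-variable polynomials, which have only finitely many zeros.\<close>

lemma prime_cone_Pts:
  assumes "finite I" "I \<noteq> {}"
  shows "prime_cone I (Pts I)"
proof -
  have "(\<forall>x\<in>Pts I. f x = 0) \<or> (\<forall>x\<in>Pts I. g x = 0)"
    if fg: "f \<in> forms I d" "g \<in> forms I e" "\<forall>x\<in>Pts I. f x * g x = 0" for d e f g
  proof (rule ccontr)
    assume "\<not> ?thesis"
    then obtain a b where ab: "a \<in> Pts I" "f a \<noteq> 0" "b \<in> Pts I" "g b \<noteq> 0" by blast
    obtain k where k: "a k \<noteq> 0" using Pts_nonzero_coord[OF ab(1)] by blast
    define line where "line t i = a i + t * (b i - a i)" for t i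
    have restrict_line: "\<exists>P. \<forall>t. poly P t = h (line t)" if "h \<in> forms I n" for h n
    proof -
      obtain c where c: "h = (\<lambda>x. \<Sum>a\<in>expo I n. c a * xpow I a x)"
        using \<open>h \<in> forms I n\<close> by (auto simp: forms_def)
      show ?thesis
        by (rule exI[of _ "\<Sum>e\<in>expo I n. smult (c e) (\<Prod>i\<in>I. [:a i, b i - a i:] ^ e i)"])
          (simp add: c poly_sum poly_prod xpow_def line_def)
    qed
    obtain P Q where PQ: "\<And>t. poly P t = f (line t)" "\<And>t. poly Q t = g (line t)"
      using restrict_line fg(1,2) by metis
    \<comment> \<open>The coordinate \<open>k\<close> along the line; its nonvanishing keeps the
      chosen point from being the zero vector.\<close>
    define R where "R = [:a k, b k - a k:]"
    have ends: "line 0 = a" "line 1 = b" by (auto simp: line_def)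
    have "P \<noteq> 0" "Q \<noteq> 0" using PQ(1)[of 0] PQ(2)[of 1] ab ends by auto
    moreover have "R \<noteq> 0" using k by (simp add: R_def)
    ultimately have "P * Q * R \<noteq> 0" by simp
    then have "finite {t. poly (P * Q * R) t = 0}" by (rule poly_roots_finite)
    then obtain t where t: "poly (P * Q * R) t \<noteq> 0"
      using infinite_UNIV_char_0[where 'a=complex] by (metis (mono_tags, lifting) UNIV_eq_I mem_Collect_eq)
    then have PQR: "poly P t \<noteq> 0" "poly Q t \<noteq> 0" "poly R t \<noteq> 0" by auto
    then have "line t k \<noteq> 0" by (simp add: line_def R_def)
    then have "line t \<in> Pts I" using ab(1,3) by (intro PtsI[of _ _ k]) (auto simp: Pts_def line_def)
    then show False using fg(3) PQR(1,2) by (auto simp: PQ)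
  qed
  moreover have "(\<lambda>i. if i \<in> I then 1 else 0) \<in> Pts I" using assms by (auto simp: Pts_def fun_eq_iff)
  ultimately show ?thesis unfolding prime_cone_def by blast
qed

text \<open>A form vanishing on \<open>S\<close> vanishes on its closure, so both sets have the same
  homogeneous ideal.\<close>

lemma prime_cone_zcl:
  assumes "S \<subseteq> Pts {..N}" "prime_cone {..N} S"
  shows "prime_cone {..N} (zcl N S)"
proof -
  have sub: "S \<subseteq> zcl N S" using zcl_superset[OF assms(1)] .
  have "(\<forall>x\<in>zcl N S. f x = 0) \<or> (\<forall>x\<in>zcl N S. g x = 0)"
    if fg: "f \<in> forms {..N} d" "g \<in> forms {..N} e" "\<forall>x\<in>zcl N S. f x * g x = 0" for d e f g
  proof -
    have "\<forall>x\<in>S. f x * g x = 0" using fg(3) sub by blast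
    then have "(\<forall>x\<in>S. f x = 0) \<or> (\<forall>x\<in>S. g x = 0)"
      using assms(2) fg(1,2) unfolding prime_cone_def by blast
    then show ?thesis
      using form_zcl_zero[OF fg(1) assms(1)] form_zcl_zero[OF fg(2) assms(1)] by blast
  qed
  moreover have "zcl N S \<noteq> {}" using assms(2) sub by (auto simp: prime_cone_def)
  ultimately show ?thesis unfolding prime_cone_def by blast
qed

text \<open>If f g vanishes on \<open>S\<close>, then \<open>S\<close> is the union of two zero
  loci; conversely, forms separating points of \<open>S\<close> from two proper closed parts have a
  product vanishing on their union. The prime formulation is the one that passes to products and
  closures.\<close>

lemma zirred_iff: "zirred N S \<longleftrightarrow> zcone {..N} S \<and> prime_cone {..N} S"
proof
  assume S: "zirred N S"
  have zc: "zcone {..N} S" and ne: "S \<noteq> {}"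
    using S by (auto simp: zirred_def zclosed_iff)
  have "(\<forall>x\<in>S. f x = 0) \<or> (\<forall>x\<in>S. g x = 0)"
    if fg: "f \<in> forms {..N} d" "g \<in> forms {..N} e" "\<forall>x\<in>S. f x * g x = 0" for d e f g
  proof -
    have "S = {x\<in>S. f x = 0} \<union> {x\<in>S. g x = 0}" using fg(3) by auto
    then have "S = {x\<in>S. f x = 0} \<or> S = {x\<in>S. g x = 0}"
      using S zcone_zero_locus[OF zc fg(1)] zcone_zero_locus[OF zc fg(2)]
      unfolding zirred_def zclosed_iff by blast
    then show ?thesis by blast
  qed
  then show "zcone {..N} S \<and> prime_cone {..N} S" using zc ne unfolding prime_cone_def by blast
next
  assume S: "zcone {..N} S \<and> prime_cone {..N} S"
  have "S = A \<or> S = B" if AB: "zcone {..N} A" "zcone {..N} B" "S = A \<union> B" for A B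
  proof (rule ccontr)
    assume "\<not> ?thesis"
    then obtain a b where ab: "a \<in> S" "a \<notin> A" "b \<in> S" "b \<notin> B" using AB(3) by blast
    then have "a \<in> Pts {..N}" "b \<in> Pts {..N}" using S by (auto simp: zcone_def)
    then obtain d f e g where f: "f \<in> forms {..N} d" "\<And>y. y \<in> A \<Longrightarrow> f y = 0" "f a \<noteq> 0"
      and g: "g \<in> forms {..N} e" "\<And>y. y \<in> B \<Longrightarrow> g y = 0" "g b \<noteq> 0"
      using zcone_separate[OF AB(1) _ ab(2)] zcone_separate[OF AB(2) _ ab(4)] by metis
    obtain z where "z \<in> S" "f z \<noteq> 0" "g z \<noteq> 0"
      using prime_coneD[of "{..N}" S f d g e a b] S f(1,3) g(1,3) ab(1,3) by blast
    then show False using AB(3) f(2) g(2) by blast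
  qed
  then show "zirred N S" using S by (auto simp: zirred_def zclosed_iff prime_cone_def)
qed

lemma zchain_bound:
  assumes "zchain N S n" "J \<subseteq> {..N}" "J \<noteq> {}" "\<And>x. x \<in> S \<Longrightarrow> \<exists>j\<in>J. x j \<noteq> 0"
  shows "n \<le> card J - 1"
proof -
  obtain Z where Z: "\<And>i. i \<le> n \<Longrightarrow> zirred N (Z i) \<and> Z i \<subseteq> S" "\<And>i. i < n \<Longrightarrow> Z i \<subset> Z (Suc i)"
    using assms(1) by (auto simp: zchain_def)
  obtain j where "j \<in> J" using assms(3) by blast
  then show ?thesis
    using chain_length_bound[of "{..N}" J j n Z] Z assms(2,4) unfolding zirred_iff by blast
qed

section \<open>Hadamard powers of the curve\<close>

lemma foldr_hprod_support: "i > N \<Longrightarrow> foldr hprod ps (ones N) i = 0"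
  by (induction ps) (auto simp: hprod_def ones_def)

lemma hdecomp_pts: "hdecomp N X p m \<Longrightarrow> p \<in> pts N"
  by (simp add: hdecomp_def)

lemma hdecomp_0: "hdecomp N X p 0 \<longleftrightarrow> p \<in> pts N \<and> (\<exists>c. c \<noteq> 0 \<and> p = (\<lambda>i. c * ones N i))"
  by (simp add: hdecomp_def)

lemma hdecomp_Suc: "hdecomp N X p (Suc m) \<longleftrightarrow>
    p \<in> pts N \<and> (\<exists>u\<in>X. \<exists>q. hdecomp N X q m \<and> p = hprod u q)"
proof
  assume p: "hdecomp N X p (Suc m)"
  then obtain ps c where ps: "length ps = Suc m" "set ps \<subseteq> X" "c \<noteq> 0"
    "p = (\<lambda>i. c * foldr hprod ps (ones N) i)" by (auto simp: hdecomp_def)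
  then obtain u qs where qs: "ps = u # qs" "length qs = m" "set qs \<subseteq> X" "u \<in> X"
    by (cases ps) auto
  \<comment> \<open>The scalar moves into the tail, so that \<open>u\<close> itself stays in
    \<open>X\<close>.\<close>
  define q where "q i = c * foldr hprod qs (ones N) i" for i
  have pq: "p = hprod u q" by (auto simp: ps(4) qs(1) q_def hprod_def)
  have "p \<in> pts N" using p by (simp add: hdecomp_def)
  then obtain i where "p i \<noteq> 0" by (auto simp: pts_def)
  then have "q i \<noteq> 0" by (auto simp: pq hprod_def)
  then have "q \<in> pts N" using foldr_hprod_support[of N _ qs] by (auto simp: pts_def q_def fun_eq_iff)
  then have "hdecomp N X q m"
    unfolding hdecomp_def using qs ps(3) by (auto simp: q_def[abs_def])
  then show "p \<in> pts N \<and> (\<exists>u\<in>X. \<exists>q. hdecomp N X q m \<and> p = hprod u q)"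
    using \<open>p \<in> pts N\<close> pq qs(4) by blast
next
  assume p: "p \<in> pts N \<and> (\<exists>u\<in>X. \<exists>q. hdecomp N X q m \<and> p = hprod u q)"
  then obtain u qs c where u: "u \<in> X" "length qs = m" "set qs \<subseteq> X" "c \<noteq> 0"
    "p = hprod u (\<lambda>i. c * foldr hprod qs (ones N) i)" by (auto simp: hdecomp_def)
  then have "p = (\<lambda>i. c * foldr hprod (u # qs) (ones N) i)" by (auto simp: hprod_def)
  then show "hdecomp N X p (Suc m)" unfolding hdecomp_def using p u
    by (intro conjI exI[of _ "u # qs"] exI[of _ c]) auto
qed

text \<open>A form on the translate pulls back to a form on \<open>X\<close>. The multiplier may
  have zero coordinates, as those in \<open>zchain_D\<close> can.\<close>

lemma prime_cone_translate:
  assumes "finite I" "prime_cone I X"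
  shows "prime_cone I (hprod w ` X)"
proof -
  have "(\<forall>x\<in>hprod w ` X. f x = 0) \<or> (\<forall>x\<in>hprod w ` X. g x = 0)"
    if fg: "f \<in> forms I d" "g \<in> forms I e" "\<forall>x\<in>hprod w ` X. f x * g x = 0" for d e f g
  proof -
    have "\<forall>x\<in>X. f (hprod w x) * g (hprod w x) = 0" using fg(3) by blast
    then have "(\<forall>x\<in>X. f (hprod w x) = 0) \<or> (\<forall>x\<in>X. g (hprod w x) = 0)"
      using assms(2) form_hprod[OF assms(1) fg(1), of w] form_hprod[OF assms(1) fg(2), of w]
      unfolding prime_cone_def by blast
    then show ?thesis by blast
  qed
  moreover have "hprod w ` X \<noteq> {}" using assms(2) by (simp add: prime_cone_def)
  ultimately show ?thesis unfolding prime_cone_def by blast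
qed

definition zeros :: "nat \<Rightarrow> (nat \<Rightarrow> complex) \<Rightarrow> nat set" where
  "zeros N x = {i\<in>{..N}. x i = 0}"

locale hadamard_curve =
  fixes N :: nat and C :: "(nat \<Rightarrow> complex) set"
  assumes N2: "N \<ge> 2"
    and irr: "zirred N C" and dim1: "zdim N C = 1"
    and noDelta: "C \<inter> Delta N = {}"
begin

text \<open>The m-fold products without closure. For m <= N they turn out to be closed, and
  \<open>hpow_eq\<close> identifies them with the Hadamard powers.\<close>

definition D :: "nat \<Rightarrow> (nat \<Rightarrow> complex) set" where
  "D m = {p. hdecomp N C p m}"

lemma zcone_C: "zcone {..N} C" and prime_C: "prime_cone {..N} C"
  using irr by (auto simp: zirred_iff)

lemma C_pts: "p \<in> C \<Longrightarrow> p \<in> Pts {..N}"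
  using zcone_C by (auto simp: zcone_def)

lemma C_one_zero: "p \<in> C \<Longrightarrow> i \<le> N \<Longrightarrow> j \<le> N \<Longrightarrow> p i = 0 \<Longrightarrow> p j = 0 \<Longrightarrow> i = j"
  using noDelta C_pts by (auto simp: Delta_def pts_eq)

lemma card_zeros_C: "p \<in> C \<Longrightarrow> card (zeros N p) \<le> 1"
  using C_one_zero by (auto simp: zeros_def card_le_Suc0_iff_eq)

lemma D_pts: "D m \<subseteq> Pts {..N}"
  by (auto simp: D_def hdecomp_def pts_eq)

lemma card_zeros_D: "p \<in> D m \<Longrightarrow> card (zeros N p) \<le> m"
proof (induction m arbitrary: p)
  case 0
  then show ?case by (auto simp: D_def hdecomp_0 zeros_def ones_def)
next
  case (Suc m)
  then obtain u q where u: "u \<in> C" "q \<in> D m" "p = hprod u q" by (auto simp: D_def hdecomp_Suc)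
  have "zeros N p \<subseteq> zeros N u \<union> zeros N q" by (auto simp: zeros_def u hprod_def)
  then have "card (zeros N p) \<le> card (zeros N u \<union> zeros N q)"
    by (intro card_mono) (auto simp: zeros_def)
  also have "\<dots> \<le> card (zeros N u) + card (zeros N q)" by (rule card_Un_le)
  finally show ?case using card_zeros_C[OF u(1)] Suc.IH[OF u(2)] by linarith
qed

lemma nonzero_among:
  assumes "card (zeros N p) < card J" "J \<subseteq> {..N}"
  shows "\<exists>j\<in>J. p j \<noteq> 0"
proof (rule ccontr)
  assume "\<not> ?thesis"
  then have "J \<subseteq> zeros N p" using assms(2) by (auto simp: zeros_def)
  then have "card J \<le> card (zeros N p)" by (intro card_mono) (auto simp: zeros_def)
  then show False using assms(1) by simp
qed

text \<open>At most m + 1 <= N of the N + 1 coordinates vanish.\<close>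

lemma hprod_pts:
  assumes "u \<in> C" "q \<in> D m" "m < N"
  shows "hprod u q \<in> Pts {..N}"
proof -
  have "zeros N (hprod u q) \<subseteq> zeros N u \<union> zeros N q" by (auto simp: zeros_def hprod_def)
  then have "card (zeros N (hprod u q)) \<le> card (zeros N u \<union> zeros N q)"
    by (intro card_mono) (auto simp: zeros_def)
  also have "\<dots> \<le> card (zeros N u) + card (zeros N q)" by (rule card_Un_le)
  also have "\<dots> \<le> 1 + m" by (intro add_mono card_zeros_C card_zeros_D assms)
  finally obtain j where "j \<le> N" "hprod u q j \<noteq> 0"
    using nonzero_among[of "hprod u q" "{..N}"] assms(3) by auto
  then show ?thesis
    using D_pts assms(2) by (intro PtsI[of _ _ j]) (auto simp: hprod_def Pts_def)
qed

lemma D_Suc: "m < N \<Longrightarrow> D (Suc m) = {hprod u q | u q. u \<in> C \<and> q \<in> D m}"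
  using hprod_pts by (auto simp: D_def hdecomp_Suc pts_eq)

lemma ones_Pts: "ones N \<in> Pts {..N}"
  by (rule PtsI[of _ _ 0]) (auto simp: ones_def)

lemma D_0: "D 0 = {\<lambda>i. c * ones N i | c. c \<noteq> 0}"
  using Pts_scale[OF ones_Pts] by (auto simp: D_def hdecomp_0 pts_eq)

text \<open>The point (1:...:1) is cut out by the linear forms x_i - x_0.\<close>

lemma zcone_D0: "zcone {..N} (D 0)"
proof (rule zconeI[OF D_pts])
  fix x assume x: "x \<in> Pts {..N}"
    "\<And>d f. f \<in> forms {..N} d \<Longrightarrow> (\<And>y. y \<in> D 0 \<Longrightarrow> f y = 0) \<Longrightarrow> f x = 0"
  have eq: "x i = x 0" if "i \<le> N" for i
  proof -
    have "(\<lambda>x. x i + (-1) * x 0) \<in> forms {..N} 1"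
      using that by (intro forms_add forms_scale forms_coord) auto
    then have "x i + (-1) * x 0 = 0"
      by (rule x(2)) (use that in \<open>auto simp: D_0 ones_def\<close>)
    then show ?thesis by simp
  qed
  obtain i where "i \<le> N" "x i \<noteq> 0" using Pts_nonzero_coord[OF x(1)] by auto
  then have "x 0 \<noteq> 0" using eq by metis
  moreover have "x = (\<lambda>i. x 0 * ones N i)"
  proof
    fix i show "x i = x 0 * ones N i"
      using eq[of i] x(1) by (cases "i \<le> N") (simp_all add: ones_def Pts_def)
  qed
  ultimately show "x \<in> D 0" unfolding D_0 by blast
qed

lemma zcone_D: "m \<le> N \<Longrightarrow> zcone {..N} (D m)"
proof (induction m)
  case 0
  show ?case by (rule zcone_D0)
next
  case (Suc m)
  then show ?case using zcone_hprod[OF _ zcone_C, of "D m"] hprod_pts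
    by (simp add: D_Suc)
qed

lemma prime_D: "m \<le> N \<Longrightarrow> prime_cone {..N} (D m)"
proof (induction m)
  case 0
  show ?case unfolding D_0 by (rule prime_cone_line) simp
next
  case (Suc m)
  then show ?case using prime_cone_hprod[OF _ prime_C, of "D m"] by (simp add: D_Suc)
qed

text \<open>As \<open>D (Suc m)\<close> is closed, the closure in \<open>hstar\<close> adds nothing,
  and by \<open>hprod_pts\<close> all products involved are defined.\<close>

lemma hpow_eq: "m \<le> N \<Longrightarrow> hpow N C m = D m"
proof (induction m)
  case 0
  show ?case by (auto simp: D_def hdecomp_0)
next
  case (Suc m)
  then have "{hprod p q | p q. p \<in> C \<and> q \<in> D m \<and> hprod p q \<in> pts N} = D (Suc m)"
    using hprod_pts[of _ _ m] unfolding pts_eq by (simp add: D_Suc) blast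
  then show ?case using Suc zcl_eq[OF zcone_D[OF Suc.prems]] by (simp add: hstar_def)
qed

lemma eta_eq: "r \<le> N \<Longrightarrow> eta N C r = (\<Union>m\<in>{1..r}. D m)"
proof -
  assume r: "r \<le> N"
  have "{p\<in>pts N. \<exists>m. 1 \<le> m \<and> m \<le> r \<and> hdecomp N C p m} = (\<Union>m\<in>{1..r}. D m)"
    by (auto simp: D_def dest: hdecomp_pts)
  moreover have "zcone {..N} (\<Union>m\<in>{1..r}. D m)" using r by (intro zcone_UN zcone_D) auto
  ultimately show ?thesis by (simp add: eta_def zcl_eq)
qed

section \<open>Chains and dimension\<close>

lemma C_meets_coordinate_hyperplane:
  assumes "i \<le> N"
  obtains q where "q \<in> C" "q i = 0"
proof -
  have "\<exists>q\<in>C. q i = 0"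
  proof (rule ccontr)
    assume "\<not> ?thesis"
    \<comment> \<open>For the single coordinate \<open>i\<close> the chain bound is
      \<open>card {i} - 1\<close>, which is 0.\<close>
    then have "n \<le> 0" if "zchain N C n" for n
      using zchain_bound[OF that, of "{i}"] assms by auto
    then have "zdim N C \<le> 0" unfolding zdim_def by (intro Sup_least) (auto simp: zero_enat_def)
    then show False using dim1 by simp
  qed
  then show thesis using that by blast
qed

text \<open>A point of \<open>C\<close> on another hyperplane x_i = 0 cannot vanish at
  \<open>j\<close> as well, so multiplying by it keeps coordinate \<open>j\<close> nonzero. This
  supplies the witness of strictness in \<open>zchain_D\<close>.\<close>

lemma D_coordinate_nonzero:
  assumes "j \<le> N" "m \<le> N"
  shows "\<exists>y\<in>D m. y j \<noteq> 0"
  using assms(2)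
proof (induction m)
  case 0
  have "ones N \<in> D 0" unfolding D_0 by (intro CollectI exI[of _ 1]) simp
  then show ?case using assms(1) by (intro bexI[of _ "ones N"]) (simp_all add: ones_def)
next
  case (Suc m)
  define i where "i = (if j = 0 then 1 else 0 :: nat)"
  have i: "i \<le> N" "i \<noteq> j" using N2 by (auto simp: i_def)
  obtain q where q: "q \<in> C" "q i = 0" using C_meets_coordinate_hyperplane[OF i(1)] .
  then have "q j \<noteq> 0" using C_one_zero i assms(1) by blast
  moreover obtain y where "y \<in> D m" "y j \<noteq> 0" using Suc by auto
  ultimately show ?case using q Suc.prems
    by (intro bexI[of _ "hprod q y"]) (auto simp: hprod_def[of q y] D_Suc, auto simp: hprod_def)
qed

text \<open>With $q_j \in C$ on the hyperplane $x_j = 0$, the closures of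
  $q_0 \star \dots \star q_{r-i-1} \star C^{\star i}$ increase strictly with $i$:
  the coordinate $x_{r-i-1}$ vanishes on the $i$-th of them but not on the next.\<close>

lemma zchain_D:
  assumes "r \<le> N"
  shows "zchain N (D r) r"
proof -
  have "\<forall>j. \<exists>q. j \<le> N \<longrightarrow> q \<in> C \<and> q j = 0"
    using C_meets_coordinate_hyperplane by metis
  then obtain q where q: "\<And>j. j \<le> N \<Longrightarrow> q j \<in> C" "\<And>j. j \<le> N \<Longrightarrow> q j j = 0"
    by metis
  \<comment> \<open>The partial products of q_0, ..., q_(k-1).\<close>
  define w where "w = rec_nat (ones N) (\<lambda>k u. hprod u (q k))"
  have w: "w 0 = ones N" "\<And>k. w (Suc k) = hprod (w k) (q k)" by (simp_all add: w_def)
  \<comment> \<open>Among the coordinates 0, ..., N each q_j vanishes at \<open>j\<close> only, so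
    \<open>w k\<close> has no zero at k, ..., N.\<close>
  have w_nonzero: "w k l \<noteq> 0" if "k \<le> l" "l \<le> N" for k l
    using that(1)
  proof (induction k)
    case 0
    then show ?case using that(2) by (simp add: w ones_def)
  next
    case (Suc k)
    then have "k \<le> N" "k \<noteq> l" using that(2) by auto
    then have "q k l \<noteq> 0" using C_one_zero[OF q(1) _ that(2) q(2)] by blast
    then show ?case using Suc by (simp add: w hprod_def)
  qed
  define V where "V i = hprod (w (r - i)) ` D i" for i
  have V_Suc: "V i \<subseteq> V (Suc i)" if "i < r" for i
  proof
    fix x assume "x \<in> V i"
    then obtain y where y: "y \<in> D i" "x = hprod (w (r - i)) y" by (auto simp: V_def)
    let ?k = "r - Suc i"
    \<comment> \<open>The last factor of the multiplier is handed over to the power of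
      \<open>C\<close>.\<close>
    have "r - i = Suc ?k" using that by simp
    then have "x = hprod (w ?k) (hprod (q ?k) y)" by (simp add: y(2) w(2) hprod_assoc)
    moreover have "q ?k \<in> C" using assms by (intro q(1)) simp
    then have "hprod (q ?k) y \<in> D (Suc i)"
      using y(1) that assms D_Suc[of i] by auto
    ultimately show "x \<in> V (Suc i)" unfolding V_def by blast
  qed
  have "hprod (ones N) y = y" if "y \<in> D r" for y
    using D_pts[of r] that by (auto simp: fun_eq_iff hprod_def ones_def Pts_def)
  then have V_r: "V r = D r" by (simp add: V_def w(1))
  have V_D: "V i \<subseteq> D r" if "i \<le> r" for i
    using that by (induction i rule: inc_induct) (use V_Suc V_r in auto)
  then have V_pts: "V i \<subseteq> Pts {..N}" if "i \<le> r" for i using that D_pts by blast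
  have prime_V: "prime_cone {..N} (V i)" if "i \<le> r" for i
    unfolding V_def by (rule prime_cone_translate) (use that assms in \<open>auto intro: prime_D\<close>)
  have "zirred N (zcl N (V i)) \<and> zcl N (V i) \<subseteq> D r" if "i \<le> r" for i
    using zcl_zcone prime_cone_zcl[OF V_pts prime_V] zcl_minimal[OF zcone_D[OF assms] V_D] that
    by (simp add: zirred_iff)
  moreover have "zcl N (V i) \<subset> zcl N (V (Suc i))" if "i < r" for i
  proof -
    have sup: "V (Suc i) \<subseteq> zcl N (V (Suc i))" using that by (intro zcl_superset V_pts) simp
    then have "zcl N (V i) \<subseteq> zcl N (V (Suc i))"
      using V_Suc[OF that] by (intro zcl_minimal zcl_zcone) blast
    moreover have "zcl N (V i) \<noteq> zcl N (V (Suc i))"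
    proof
      assume eq: "zcl N (V i) = zcl N (V (Suc i))"
      let ?k = "r - Suc i"
      have k: "?k \<le> N" "r - i = Suc ?k" using that assms by auto
      \<comment> \<open>Both \<open>w ?k\<close> and \<open>y\<close> are nonzero at
        \<open>?k\<close>, and so is their product, whereas every element of \<open>V i\<close> has
        the factor \<open>q ?k\<close> and vanishes there.\<close>
      obtain y where y: "y \<in> D (Suc i)" "y ?k \<noteq> 0"
        using D_coordinate_nonzero[OF k(1), of "Suc i"] \<open>i < r\<close> assms by auto
      let ?x = "hprod (w ?k) y"
      have "?x \<in> V (Suc i)" unfolding V_def using y(1) by (rule imageI)
      then have mem: "?x \<in> zcl N (V i)" using sup eq by (metis subsetD)
      have zero: "x ?k = 0" if "x \<in> V i" for x
      proof -
        obtain z where "x = hprod (hprod (w ?k) (q ?k)) z"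
          using \<open>x \<in> V i\<close> unfolding V_def k(2) w(2) by blast
        then show ?thesis using q(2)[OF k(1)] by (simp add: hprod_def)
      qed
      have "(\<lambda>x. x ?k) \<in> forms {..N} 1" using k(1) by (intro forms_coord) auto
      then have "?x ?k = 0" using V_pts[OF less_imp_le[OF \<open>i < r\<close>]] zero mem by (rule form_zcl_zero)
      then show False using w_nonzero[OF order_refl k(1)] y(2) by (simp add: hprod_def)
    qed
    ultimately show ?thesis by blast
  qed
  ultimately show ?thesis unfolding zchain_def by (intro exI[of _ "\<lambda>i. zcl N (V i)"]) blast
qed

lemma zdim_eta:
  assumes "1 \<le> r" "r \<le> N"
  shows "zdim N (eta N C r) = enat r"
proof (rule antisym)
  have "n \<le> r" if "zchain N (eta N C r) n" for n
  proof -
    \<comment> \<open>There are r + 1 coordinates 0, ..., r and at most r zeros. This holds on every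
      \<open>D m\<close> in the union, so the bound covers \<open>eta\<close> without comparing
      these sets.\<close>
    have "\<exists>j\<in>{..r}. x j \<noteq> 0" if "x \<in> eta N C r" for x
    proof -
      obtain m where "m \<le> r" "x \<in> D m" using \<open>x \<in> eta N C r\<close> by (auto simp: eta_eq[OF assms(2)])
      then show ?thesis using card_zeros_D[of x m] assms(2) by (intro nonzero_among) auto
    qed
    then show ?thesis using zchain_bound[OF that, of "{..r}"] assms(2) by auto
  qed
  then show "zdim N (eta N C r) \<le> enat r" unfolding zdim_def by (intro Sup_least) auto
  have "D r \<subseteq> eta N C r" using assms by (auto simp: eta_eq)
  then have "zchain N (eta N C r) r" using zchain_D[OF assms(2)] unfolding zchain_def by blast
  then show "enat r \<le> zdim N (eta N C r)" unfolding zdim_def by (intro Sup_upper) blast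
qed

text \<open>Otherwise the irreducible \<open>pts N\<close> could be put on top of the chain of
  length \<open>N\<close> in \<open>D N\<close>, and the resulting length N + 1 exceeds what N + 1
  coordinates allow.\<close>

lemma D_N: "D N = pts N"
proof (rule ccontr)
  assume ne: "D N \<noteq> pts N"
  obtain Z where Z: "\<And>i. i \<le> N \<Longrightarrow> zirred N (Z i) \<and> Z i \<subseteq> D N" "\<And>i. i < N \<Longrightarrow> Z i \<subset> Z (Suc i)"
    using zchain_D[OF order_refl] by (auto simp: zchain_def)
  define Z' where "Z' i = (if i \<le> N then Z i else pts N)" for i
  have pts: "zirred N (pts N)"
    unfolding zirred_iff pts_eq using zcone_Pts prime_cone_Pts[of "{..N}"] by auto
  have "Z N \<subset> pts N" using Z(1)[of N] D_pts[of N] ne by (auto simp: pts_eq)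
  then have "Z' i \<subset> Z' (Suc i)" if "i < Suc N" for i
    using that Z(2)[of i] by (cases "i = N") (auto simp: Z'_def)
  moreover have "zirred N (Z' i) \<and> Z' i \<subseteq> pts N" for i
    using Z(1)[of i] D_pts[of N] pts by (auto simp: Z'_def pts_eq)
  ultimately have "zchain N (pts N) (Suc N)" unfolding zchain_def by blast
  then have "Suc N \<le> card {..N} - 1"
    by (rule zchain_bound) (auto simp: pts_eq dest: Pts_nonzero_coord)
  then show False by simp
qed

section \<open>Rank, border rank and generic rank\<close>

lemma hdecomp_N: "p \<in> pts N \<Longrightarrow> hdecomp N C p N"
  using D_N by (auto simp: D_def)

lemma ranks:
  assumes "p \<in> pts N"
  shows "bHrk N C p = Hrk N C p" "Hrk N C p \<le> enat N"
proof -
  define m where "m = (LEAST m. hdecomp N C p m)"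
  have m: "hdecomp N C p m" "m \<le> N"
    unfolding m_def using hdecomp_N[OF assms] by (auto intro: LeastI Least_le)
  have mem: "p \<in> hpow N C m" using hpow_eq[OF m(2)] m(1) by (simp add: D_def)
  have "(LEAST m. p \<in> hpow N C m) = m"
  proof (rule Least_equality)
    show "p \<in> hpow N C m" by (rule mem)
    fix n assume n: "p \<in> hpow N C n"
    show "m \<le> n"
    \<comment> \<open>\<open>hpow\<close> is identified with plain products up to exponent
      \<open>N\<close>; for larger \<open>n\<close> the bound m <= N suffices.\<close>
    proof (cases "n \<le> N")
      case True
      then show ?thesis using n hpow_eq[OF True] unfolding m_def by (auto simp: D_def intro: Least_le)
    qed (use m(2) in simp)
  qed
  moreover have H: "Hrk N C p = enat m" using m(1) unfolding Hrk_def m_def by auto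
  ultimately show "bHrk N C p = Hrk N C p" using mem unfolding bHrk_def by auto
  show "Hrk N C p \<le> enat N" using m(2) H by simp
qed

lemma generic_rank:
  "\<exists>Z. zclosed N Z \<and> Z \<noteq> pts N \<and> (\<forall>p\<in>pts N - Z. Hrk N C p = enat N)"
proof -
  \<comment> \<open>The points of rank less than \<open>N\<close>; \<open>D 0\<close> is among them
    because (1:...:1) has rank 0.\<close>
  let ?Z = "\<Union>m\<in>{..<N}. D m"
  define e where "e = (\<lambda>i. if i = N then 1 else 0 :: complex)"
  have "zeros N e = {..<N}" by (auto simp: zeros_def e_def)
  then have "e \<notin> ?Z" using card_zeros_D[of e] by fastforce
  moreover have "e \<in> pts N" unfolding pts_eq by (rule PtsI[of _ _ N]) (auto simp: e_def)
  ultimately have "?Z \<noteq> pts N" by blast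
  moreover have "zclosed N ?Z" unfolding zclosed_iff by (intro zcone_UN zcone_D) auto
  moreover have "Hrk N C p = enat N" if p: "p \<in> pts N - ?Z" for p
  proof -
    have "(LEAST m. hdecomp N C p m) = N"
    proof (rule Least_equality)
      show "hdecomp N C p N" using p hdecomp_N by blast
      show "N \<le> m" if "hdecomp N C p m" for m
        using that p by (force simp: D_def not_less[symmetric])
    qed
    then show ?thesis using p hdecomp_N[of p] by (auto simp: Hrk_def)
  qed
  ultimately show ?thesis by blast
qed

end

theorem mainTheorem11:
  fixes N :: nat and C :: "(nat \<Rightarrow> complex) set"
  assumes "N \<ge> 2"
    and "zirred N C" and "zdim N C = 1"
    and "C \<inter> Delta N = {}"
  shows "(\<forall>r. 1 \<le> r \<and> r \<le> N \<longrightarrow> zdim N (eta N C r) = enat r)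
       \<and> (\<forall>p\<in>pts N. bHrk N C p = Hrk N C p \<and> Hrk N C p \<le> enat N)
       \<and> (\<exists>Z. zclosed N Z \<and> Z \<noteq> pts N \<and> (\<forall>p\<in>pts N - Z. Hrk N C p = enat N))"
proof -
  interpret hadamard_curve N C by unfold_locales (fact assms)+
  show ?thesis using zdim_eta ranks generic_rank by blast
qed

end
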